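(* Let $\tilde\alpha\in\widetilde{PSL_2\mathbb R}$. Then $$\Theta(\tilde\alpha)=\tfrac12\,\mathrm{Tw}(\tilde\alpha,i),$$ where $i$ is the point $\sqrt{-1}$ of the upper half plane model of $\mathbb H^2$ and $\Theta$ is Milnor's angle function.
   Context: $\mathbb H^2$ is the upper half plane with its standard orientation, on which $SL_2\mathbb R$ acts by fractional linear transformations; $PSL_2\mathbb R=\mathrm{Isom}^+\mathbb H^2$. $\widetilde{PSL_2\mathbb R}=\widetilde{SL_2\mathbb R}$ is the universal covering group, whose elements are homotopy classes rel endpoints of paths $(g_t)_{t\in[0,1]}$ in $PSL_2\mathbb R$ with $g_0=1$; the image of such a class in $PSL_2\mathbb R$ is $g_1$. Twist at $y\in\mathbb H^2$: let $\tilde\alpha\in\widetilde{PSL_2\mathbb R}$ be represented by $(g_t)$, with image $\alpha=g_1$. Let $c:[0,1]\to\mathbb H^2$ be the constant speed (possibly constant) geodesic from $y$ to $\alpha(y)$. For a unit tangent vector $u$ at $y$, choose a path $\mathcal V:[0,1]\to UT\mathbb H^2$ of unit tangent vectors along $c$ (that is, $\mathcal V(t)$ is based at $c(t)$) which is homotopic rel endpoints in $UT\mathbb H^2$ to $t\mapsto Dg_t(u)$. Then $\mathrm{Tw}(\tilde\alpha,y)\in\mathbb R$ is the total change $\theta(1)-\theta(0)$ of a continuous determination $\theta(t)$ of the anticlockwise angle from the unit velocity vector of $c$ (if $c$ is constant: from a fixed unit tangent vector at $y$) to $\mathcal V(t)$. This is independent of choices. Milnor's angle function $\Theta:\widetilde{PSL_2\mathbb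 R}\to\mathbb R$: every $\alpha\in SL_2\mathbb R$ is uniquely $\alpha=R(\alpha)S(\alpha)$ with $R(\alpha)\in SO_2\mathbb R$ and $S(\alpha)$ symmetric positive definite. The retraction $R:SL_2\mathbb R\to SO_2\mathbb R$ lifts to a retraction $\tilde R:\widetilde{SL_2\mathbb R}\to\widetilde{SO_2\mathbb R}$. The map $\exp:\mathbb R\to SO_2\mathbb R$, $\theta\mapsto\begin{pmatrix}\cos\theta&\sin\theta\\-\sin\theta&\cos\theta\end{pmatrix}$ lifts to an isomorphism $\widetilde{\exp}:\mathbb R\to\widetilde{SO_2\mathbb R}\subset\widetilde{SL_2\mathbb R}$. Then $\Theta(\tilde\alpha)=\widetilde{\exp}^{-1}(\tilde R(\tilde\alpha))$. Equivalently, $\Theta$ is the unique continuous function with $\Theta(1)=0$ such that $\exp(\Theta(\tilde\alpha))=R(\alpha)$ where $\alpha\in SL_2\mathbb R$ is the image of $\tilde\alpha$. *)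

theory Defs
  imports "HOL-Analysis.Analysis"
begin

section \<open>Universal covers as spaces of homotopy classes of paths\<close>

text \<open>A class is the set of all \<open>real \<Rightarrow> 'a\<close> homotopic to \<open>p\<close> rel endpoints in \<open>X\<close>.
  As \<^const>\<open>homotopic_paths\<close> only looks at \<open>{0..1}\<close>, values outside the unit interval are irrelevant.\<close>

definition path_class :: "'a::topological_space set \<Rightarrow> (real \<Rightarrow> 'a) \<Rightarrow> (real \<Rightarrow> 'a) set" where
  "path_class X p = {q. homotopic_paths X p q}"

definition universal_cover :: "'a::topological_space set \<Rightarrow> 'a \<Rightarrow> (real \<Rightarrow> 'a) set set" where
  "universal_cover X x = {path_class X p |p. path p \<and> path_image p \<subseteq> X \<and> pathstart p = x}"

text \<open>The lift to universal covers of a continuous map \<open>f\<close> into \<open>Y\<close>: \<open>[p] \<mapsto> [f \<circ> p]\<close>.\<close>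

definition lift_map ::
    "'b::topological_space set \<Rightarrow> ('a::topological_space \<Rightarrow> 'b) \<Rightarrow> (real \<Rightarrow> 'a) set \<Rightarrow> (real \<Rightarrow> 'b) set" where
  "lift_map Y f \<xi> = (\<Union>p\<in>\<xi>. path_class Y (f \<circ> p))"


section \<open>\<open>SL\<^sub>2(\<real>)\<close>, \<open>SO\<^sub>2(\<real>)\<close> and \<open>PSL\<^sub>2(\<real>)\<close>\<close>

definition SL2 :: "(real^2^2) set" where
  "SL2 = {A. det A = 1}"

definition SO2 :: "(real^2^2) set" where
  "SO2 = {A. rotation_matrix A}"

definition psl2_rel :: "real^2^2 \<Rightarrow> real^2^2 \<Rightarrow> bool" where
  "psl2_rel A B \<longleftrightarrow> A \<in> SL2 \<and> B \<in> SL2 \<and> (A = B \<or> A = - B)"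

quotient_type psl2 = "real^2^2" / partial: psl2_rel
proof (rule part_equivpI)
  show "\<exists>A. psl2_rel A A"
    by (rule exI[of _ "mat 1"]) (simp add: psl2_rel_def SL2_def)
qed (auto simp: psl2_rel_def intro!: sympI transpI)

text \<open>The quotient topology from \<^const>\<open>SL2\<close>.\<close>

instantiation psl2 :: topological_space
begin

definition open_psl2 :: "psl2 set \<Rightarrow> bool" where
  "open_psl2 U \<longleftrightarrow> openin (top_of_set SL2) {A \<in> SL2. abs_psl2 A \<in> U}"

instance
proof
  show "open (UNIV :: psl2 set)"
    by (simp add: open_psl2_def)
next
  fix U V :: "psl2 set"
  assume "open U" "open V"
  moreover have "{A \<in> SL2. abs_psl2 A \<in> U \<inter> V} =
      {A \<in> SL2. abs_psl2 A \<in> U} \<inter> {A \<in> SL2. abs_psl2 A \<in> V}" by auto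
  ultimately show "open (U \<inter> V)"
    by (simp add: open_psl2_def openin_Int)
next
  fix \<U> :: "psl2 set set"
  assume *: "\<forall>U\<in>\<U>. open U"
  have "{A \<in> SL2. abs_psl2 A \<in> \<Union>\<U>} = (\<Union>U\<in>\<U>. {A \<in> SL2. abs_psl2 A \<in> U})" by auto
  then show "open (\<Union>\<U>)"
    using * by (auto simp: open_psl2_def)
qed

end

definition SL2_tilde :: "(real \<Rightarrow> real^2^2) set set" where
  "SL2_tilde = universal_cover SL2 (mat 1)"

definition PSL2_tilde :: "(real \<Rightarrow> psl2) set set" where
  "PSL2_tilde = universal_cover UNIV (abs_psl2 (mat 1))"

text \<open>The canonical identification of the universal cover of \<open>SL\<^sub>2(\<real>)\<close> with that of \<open>PSL\<^sub>2(\<real>)\<close>,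
  induced by the quotient map.\<close>

definition proj_tilde :: "(real \<Rightarrow> real^2^2) set \<Rightarrow> (real \<Rightarrow> psl2) set" where
  "proj_tilde = lift_map UNIV abs_psl2"


section \<open>The action on the upper half plane and its unit tangent bundle\<close>

definition mobius :: "real^2^2 \<Rightarrow> complex \<Rightarrow> complex" where
  "mobius A z = (of_real (A$1$1) * z + of_real (A$1$2)) / (of_real (A$2$1) * z + of_real (A$2$2))"

lift_definition act :: "psl2 \<Rightarrow> complex \<Rightarrow> complex" is mobius
proof -
  fix A B assume "psl2_rel A B"
  moreover have "mobius (- C) = mobius C" for C
  proof
    fix z
    have "mobius (- C) z =
        (- (of_real (C$1$1) * z + of_real (C$1$2))) / (- (of_real (C$2$1) * z + of_real (C$2$2)))"
      by (simp add: mobius_def)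
    then show "mobius (- C) z = mobius C z"
      by (simp only: minus_divide_divide mobius_def)
  qed
  ultimately show "mobius A = mobius B"
    by (auto simp: psl2_rel_def)
qed

definition upper_half_plane :: "complex set" where
  "upper_half_plane = {z. Im z > 0}"

text \<open>The hyperbolic norm of a tangent vector \<open>v \<in> \<complex>\<close> at \<open>z\<close> is \<open>\<bar>v\<bar> / Im z\<close>.\<close>

definition UT :: "(complex \<times> complex) set" where
  "UT = {(z, v). z \<in> upper_half_plane \<and> cmod v / Im z = 1}"

definition tangent_map :: "psl2 \<Rightarrow> complex \<times> complex \<Rightarrow> complex \<times> complex" where
  "tangent_map g = (\<lambda>(z, v). (act g z, deriv (act g) z * v))"

definition hyp_dist :: "complex \<Rightarrow> complex \<Rightarrow> real" where
  "hyp_dist z w = arcosh (1 + (cmod (z - w))\<^sup>2 / (2 * Im z * Im w))"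

text \<open>Geodesics of the hyperbolic plane are globally minimizing, so constant speed geodesics are
  the paths that scale the distance by a constant factor.\<close>

definition geodesic_from_to :: "(real \<Rightarrow> complex) \<Rightarrow> complex \<Rightarrow> complex \<Rightarrow> bool" where
  "geodesic_from_to c y w \<longleftrightarrow>
     (\<forall>t\<in>{0..1}. c t \<in> upper_half_plane) \<and> c 0 = y \<and> c 1 = w \<and>
     (\<forall>s\<in>{0..1}. \<forall>t\<in>{0..1}. hyp_dist (c s) (c t) = \<bar>s - t\<bar> * hyp_dist y w)"


section \<open>The twist\<close>

text \<open>The reference direction along \<open>c\<close>: the unit velocity field, or a fixed unit vector if \<open>c\<close> is
  constant.\<close>

definition reference_field :: "(real \<Rightarrow> complex) \<Rightarrow> (real \<Rightarrow> complex) \<Rightarrow> bool" where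
  "reference_field c T \<longleftrightarrow>
     (if \<forall>t\<in>{0..1}. c t = c 0
      then \<exists>u. (c 0, u) \<in> UT \<and> (\<forall>t\<in>{0..1}. T t = u)
      else \<forall>t\<in>{0..1}. let v = vector_derivative c (at t within {0..1})
                       in T t = v /\<^sub>R (cmod v / Im (c t)))"

text \<open>\<open>\<theta>\<close> is a continuous determination of the anticlockwise angle from \<open>T\<close> to \<open>V\<close>; the metric is
  conformal to the Euclidean one, so rotation by \<open>\<theta>\<close> is multiplication by \<open>cis \<theta>\<close>.\<close>

definition angle_from_to :: "(real \<Rightarrow> complex) \<Rightarrow> (real \<Rightarrow> complex) \<Rightarrow> (real \<Rightarrow> real) \<Rightarrow> bool" where
  "angle_from_to T V \<theta> \<longleftrightarrow>
     continuous_on {0..1} \<theta> \<and> (\<forall>t\<in>{0..1}. V t = cis (\<theta> t) * T t)"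

definition is_twist :: "(real \<Rightarrow> psl2) set \<Rightarrow> complex \<Rightarrow> real \<Rightarrow> bool" where
  "is_twist \<alpha> y r \<longleftrightarrow>
     (\<exists>g c u V T \<theta>. g \<in> \<alpha> \<and> geodesic_from_to c y (act (g 1) y) \<and> (y, u) \<in> UT \<and>
        homotopic_paths UT (\<lambda>t. tangent_map (g t) (y, u)) V \<and>
        (\<forall>t\<in>{0..1}. fst (V t) = c t) \<and>
        reference_field c T \<and> angle_from_to T (snd \<circ> V) \<theta> \<and> r = \<theta> 1 - \<theta> 0)"

definition Tw :: "(real \<Rightarrow> psl2) set \<Rightarrow> complex \<Rightarrow> real" where
  "Tw \<alpha> y = (THE r. is_twist \<alpha> y r)"


section \<open>Milnor's angle function\<close>

definition sym_pos_def :: "real^2^2 \<Rightarrow> bool" where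
  "sym_pos_def S \<longleftrightarrow> transpose S = S \<and> (\<forall>x. x \<noteq> 0 \<longrightarrow> x \<bullet> (S *v x) > 0)"

definition polar_rotation :: "real^2^2 \<Rightarrow> real^2^2" where
  "polar_rotation A = (THE R. R \<in> SO2 \<and> (\<exists>S. sym_pos_def S \<and> A = R ** S))"

definition SO2_exp :: "real \<Rightarrow> real^2^2" where
  "SO2_exp \<theta> = vector [vector [cos \<theta>, sin \<theta>], vector [- sin \<theta>, cos \<theta>]]"

definition R_tilde :: "(real \<Rightarrow> real^2^2) set \<Rightarrow> (real \<Rightarrow> real^2^2) set" where
  "R_tilde = lift_map SO2 polar_rotation"

text \<open>As \<open>\<real>\<close> is simply connected, it is its own universal cover: \<open>\<theta>\<close> corresponds to the class of
  the segment from \<open>0\<close> to \<open>\<theta>\<close>, whose image under \<^const>\<open>SO2_exp\<close> is the path below.\<close>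

definition exp_tilde :: "real \<Rightarrow> (real \<Rightarrow> real^2^2) set" where
  "exp_tilde \<theta> = path_class SO2 (\<lambda>t. SO2_exp (t * \<theta>))"

definition Theta :: "(real \<Rightarrow> psl2) set \<Rightarrow> real" where
  "Theta \<alpha> = the_inv exp_tilde (R_tilde (the_inv_into SL2_tilde proj_tilde \<alpha>))"

end

theory Submission
  imports Defs
begin

text \<open>Both sides of the equation measure the winding of one and the same path of nonzero complex
  numbers, seen in the disc model of the hyperbolic plane.

  The Cayley transform \<open>z \<mapsto> (z - \<i>) / (z + \<i>)\<close> sends \<open>\<i>\<close> to the centre of the disc, and up to a
  constant factor it sends a tangent vector \<open>v\<close> at \<open>z\<close> to \<open>F (z, v) = - v / (z + \<i>)\<^sup>2\<close> (called
  \<open>disc_vector\<close> below). Geodesics through \<open>\<i>\<close> become diameters, so the argument of \<open>F\<close> is constant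
  along their velocity field (\<open>reference_field_argument\<close>). Hence for a field \<open>V\<close> of unit vectors
  along such a geodesic, the total change of the angle from the velocity to \<open>V\<close> is the total change
  of the argument of \<open>F \<circ> V\<close>. The latter only depends on the homotopy class of \<open>V\<close> rel endpoints
  among paths of unit tangent vectors (\<open>argument_along_homotopic\<close>), and thus equals the change of the
  argument of \<open>F\<close> along \<open>t \<mapsto> Dg\<^sub>t(u)\<close>.

  On the other hand, write a matrix \<open>A\<close> of determinant 1 as \<open>R S\<close> with \<open>R = exp \<theta>\<close> and \<open>S\<close> symmetric
  positive definite. Then \<open>A + (A\<^sup>T)\<inverse> = R (S + S\<inverse>) = tr(S) R\<close>, so the first row of this matrix gives
  the complex number \<open>k = (a + d) + (b - c) \<i> = tr(S) e\<^sup>i\<^sup>\<theta>\<close> (called \<open>rotation_part\<close>). A computation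
  yields \<open>F (DA(\<i>, u)) = u / (cnj k)\<^sup>2\<close>, whose argument is \<open>2 \<theta>\<close> plus that of \<open>u\<close>
  (\<open>disc_vector_tangent_map\<close>). If \<open>(g\<^sub>t)\<close> is lifted to a path of matrices starting at the identity and
  \<open>\<theta>\<close> is the continuous angle of its rotation factors with \<open>\<theta>(0) = 0\<close>, the twist is therefore
  \<open>2 \<theta>(1)\<close>, while \<open>\<theta>(1)\<close> is Milnor's angle by construction.

  Two things remain. First, the twist and the angle function must be given by their defining
  descriptions: a field \<open>V\<close> of the required kind has to exist, paths have to lift from the projective
  group to \<open>SL\<^sub>2(\<real>)\<close>, and homotopic paths must have homotopic lifts. All of this is done in polar
  coordinates: unit tangent vectors are determined by the base point \<open>z\<close> and the argument of \<open>F\<close>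
  (\<open>frame_vector\<close>), matrices by the image \<open>z\<close> of \<open>\<i>\<close> and the angle \<open>\<theta>\<close> (\<open>polar_matrix\<close>). Once the angles
  are lifted to \<open>\<real>\<close>, both coordinates live in the convex set \<open>\<H> \<times> \<real>\<close>, where straight lines are
  homotopies (\<open>homotopic_paths_coordinates\<close>). Second, the constant speed geodesics from \<open>\<i>\<close>, which are
  given by a condition on distances, must be identified with the radii of the disc
  (\<open>geodesic_from_i\<close>).\<close>


section \<open>Arguments along paths of nonzero complex numbers\<close>

lemma norm_times_cis_Arg: "of_real (cmod z) * cis (Arg z) = z"
  using rcis_cmod_Arg[of z] by (simp add: rcis_def)

lemma cis_Arg_unit: "cmod u = 1 \<Longrightarrow> cis (Arg u) = u"
  using norm_times_cis_Arg[of u] by simp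

definition argument_along :: "(real \<Rightarrow> complex) \<Rightarrow> (real \<Rightarrow> real) \<Rightarrow> bool" where
  "argument_along f \<phi> \<longleftrightarrow>
     continuous_on {0..1} \<phi> \<and> (\<forall>t\<in>{0..1}. \<exists>r>0. f t = of_real r * cis (\<phi> t))"

lemma argument_alongD:
  assumes "argument_along f \<phi>"
  shows "continuous_on {0..1} \<phi>"
    and "t \<in> {0..1} \<Longrightarrow> f t = of_real (cmod (f t)) * cis (\<phi> t)"
    and "t \<in> {0..1} \<Longrightarrow> f t \<noteq> 0"
  using assms by (force simp: argument_along_def norm_mult)+

lemma argument_alongE:
  assumes "argument_along f \<phi>" "t \<in> {0..1}"
  obtains r where "r > 0" "f t = of_real r * cis (\<phi> t)"
  using assms unfolding argument_along_def by blast

lemma argument_along_exists: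
  assumes "path f" "path_image f \<subseteq> - {0}"
  obtains \<phi> where "argument_along f \<phi>"
proof -
  have "continuous_on {0..1} f" "\<And>t. t \<in> {0..1} \<Longrightarrow> f t \<noteq> 0"
    using assms by (auto simp: path_def path_image_def)
  then obtain g where g: "continuous_on {0..1} g" "\<And>t. t \<in> {0..1} \<Longrightarrow> f t = exp (g t)"
    using continuous_logarithm_on_contractible[of "{0..1}" f]
    by (metis convex_imp_contractible convex_real_interval(5))
  have "argument_along f (\<lambda>t. Im (g t))"
    unfolding argument_along_def
    using g by (auto intro!: continuous_intros exI[of _ "exp (Re (g t))" for t] simp: exp_eq_polar)
  then show ?thesis by (rule that)
qed

lemma argument_along_exists_from_0:
  assumes "path f" "path_image f \<subseteq> - {0}" "f 0 = of_real r" "r > 0"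
  obtains \<phi> where "argument_along f \<phi>" "\<phi> 0 = 0"
proof -
  obtain \<phi> where \<phi>: "argument_along f \<phi>" using assms(1,2) by (rule argument_along_exists)
  have "of_real (cmod (f 0)) * cis (\<phi> 0) = f 0"
    using argument_alongD(2)[OF \<phi>, of 0] by simp
  then have "cis (\<phi> 0) = 1"
    using assms(3,4) by simp
  then have "cis (\<phi> t - \<phi> 0) = cis (\<phi> t)" for t
    by (simp add: cis_divide [symmetric])
  then have "argument_along f (\<lambda>t. \<phi> t - \<phi> 0)"
    using \<phi> by (auto simp: argument_along_def intro!: continuous_intros)
  then show thesis by (rule that) simp
qed

text \<open>The logarithms of the two paths, shifted to begin at the same point, are lifts of homotopic
  paths through the covering \<open>exp\<close>, so they end at the same point by monodromy.\<close>

lemma argument_along_homotopic: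
  assumes hom: "homotopic_paths (- {0}) f g"
    and \<phi>: "argument_along f \<phi>" and \<psi>: "argument_along g \<psi>"
  shows "\<phi> 1 - \<phi> 0 = \<psi> 1 - \<psi> 0"
proof -
  have f: "path f" "path_image f \<subseteq> - {0}" and g: "path g" "path_image g \<subseteq> - {0}"
    using homotopic_paths_imp_path[OF hom] homotopic_paths_imp_subset[OF hom] by auto
  note f' = argument_alongD[OF \<phi>] and g' = argument_alongD[OF \<psi>]
  have start: "f 0 = g 0" and finish: "f 1 = g 1"
    using homotopic_paths_imp_pathstart[OF hom] homotopic_paths_imp_pathfinish[OF hom]
    by (auto simp: pathstart_def pathfinish_def)
  have "of_real (cmod (f 0)) * cis (\<phi> 0) = of_real (cmod (g 0)) * cis (\<psi> 0)"
    using f'(2)[of 0] g'(2)[of 0] start by simp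
  then have cis0: "cis (\<phi> 0) = cis (\<psi> 0)"
    using start f'(3)[of 0] by simp
  define h1 where "h1 = (\<lambda>t. complex_of_real (ln (cmod (f t))) + \<i> * complex_of_real (\<phi> t))"
  define h2 where "h2 = (\<lambda>t. complex_of_real (ln (cmod (g t))) + \<i> * complex_of_real (\<psi> t - \<psi> 0 + \<phi> 0))"
  have "pathfinish h1 = pathfinish h2"
  proof (rule covering_space_monodromy[OF covering_space_exp_punctured_plane f g hom])
    show "path h1" "path h2"
      using f f' g g' unfolding h1_def h2_def path_def
      by (auto intro!: continuous_intros)
    show "exp (h1 t) = f t" if "t \<in> {0..1}" for t
    proof -
      have "exp (h1 t) = of_real (cmod (f t)) * cis (\<phi> t)"
        using f'(3)[OF that] by (simp add: h1_def exp_add exp_of_real cis_conv_exp)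
      then show ?thesis using f'(2)[OF that] by simp
    qed
    show "exp (h2 t) = g t" if "t \<in> {0..1}" for t
    proof -
      have "exp (h2 t) = of_real (cmod (g t)) * cis (\<psi> t - \<psi> 0 + \<phi> 0)"
        using g'(3)[OF that] by (simp only: h2_def exp_add exp_of_real cis_conv_exp) simp
      also have "cis (\<psi> t - \<psi> 0 + \<phi> 0) = cis (\<psi> t)"
        using cis0 by (simp add: cis_divide [symmetric] cis_mult [symmetric])
      finally show ?thesis using g'(2)[OF that] by simp
    qed
    show "pathstart h1 = pathstart h2"
      by (simp add: h1_def h2_def pathstart_def start)
  qed auto
  then have "Im (h1 1) = Im (h2 1)" by (simp add: pathfinish_def)
  then show ?thesis by (simp add: h1_def h2_def)
qed


section \<open>The rotation factor of the polar decomposition\<close>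

text \<open>For \<open>A = R S\<close> of determinant 1, the matrix \<open>A + (A\<^sup>T)\<inverse>\<close> equals \<open>tr(S) R\<close>, because
  \<open>S + S\<inverse> = tr(S)\<close> by Cayley-Hamilton. This is the first row of that matrix, read as a complex number.\<close>

definition rotation_part :: "real^2^2 \<Rightarrow> complex" where
  "rotation_part A = Complex (A$1$1 + A$2$2) (A$1$2 - A$2$1)"

lemma rotation_part_minus [simp]: "rotation_part (- A) = - rotation_part A"
  by (simp add: rotation_part_def complex_eq_iff)

lemma rotation_part_mat_1 [simp]: "rotation_part (mat 1) = 2"
  by (simp add: rotation_part_def mat_def complex_eq_iff)

text \<open>The value 0 means \<open>a = - d\<close> and \<open>b = c\<close>, which makes the determinant \<open>- (c\<^sup>2 + d\<^sup>2)\<close>.\<close>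

lemma rotation_part_nonzero:
  assumes "A \<in> SL2"
  shows "rotation_part A \<noteq> 0"
proof
  assume "rotation_part A = 0"
  then have "A$1$1 = - A$2$2" "A$1$2 = A$2$1"
    by (auto simp: rotation_part_def complex_eq_iff)
  then have "- (A$2$2 * A$2$2) - A$2$1 * A$2$1 = 1"
    using assms by (simp add: SL2_def det_2)
  then show False
    by (smt (verit) zero_le_square)
qed

lemma continuous_on_rotation_part [continuous_intros]:
  "continuous_on X rotation_part"
  unfolding rotation_part_def Complex_eq by (intro continuous_intros)

lemma mat22_eq_iff:
  fixes A B :: "real^2^2"
  shows "A = B \<longleftrightarrow> A$1$1 = B$1$1 \<and> A$1$2 = B$1$2 \<and> A$2$1 = B$2$1 \<and> A$2$2 = B$2$2"
  by (auto simp: vec_eq_iff forall_2)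

lemma continuous_on_mat22:
  assumes "continuous_on X a" "continuous_on X b" "continuous_on X c" "continuous_on X d"
  shows "continuous_on X (\<lambda>x. vector [vector [a x, b x], vector [c x, d x]] :: real^2^2)"
proof -
  have eq: "(\<lambda>x. vector [vector [a x, b x], vector [c x, d x]] :: real^2^2) =
      (\<lambda>x. a x *\<^sub>R vector [vector [1, 0], vector [0, 0]] + b x *\<^sub>R vector [vector [0, 1], vector [0, 0]] +
        c x *\<^sub>R vector [vector [0, 0], vector [1, 0]] + d x *\<^sub>R vector [vector [0, 0], vector [0, 1]])"
    by (simp add: fun_eq_iff mat22_eq_iff)
  show ?thesis unfolding eq by (intro continuous_intros assms)
qed

lemma SO2_exp_nth [simp]:
  "SO2_exp \<theta> $ 1 $ 1 = cos \<theta>" "SO2_exp \<theta> $ 1 $ 2 = sin \<theta>"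
  "SO2_exp \<theta> $ 2 $ 1 = - sin \<theta>" "SO2_exp \<theta> $ 2 $ 2 = cos \<theta>"
  by (simp_all add: SO2_exp_def)

lemma matrix_mult_22:
  fixes A B :: "real^2^2"
  shows "(A ** B) $ i $ j = A$i$1 * B$1$j + A$i$2 * B$2$j"
  by (simp add: matrix_matrix_mult_def sum_2)

lemma SO2_eq_range: "SO2 = range SO2_exp"
proof (intro set_eqI iffI)
  fix A assume "A \<in> SO2"
  then have orth: "transpose A ** A = mat 1" and det: "det A = 1"
    by (auto simp: SO2_def rotation_matrix_def orthogonal_matrix_def)
  have 1: "A$1$1 * A$1$1 + A$2$1 * A$2$1 = 1" "A$1$1 * A$1$2 + A$2$1 * A$2$2 = 0"
    "A$1$2 * A$1$2 + A$2$2 * A$2$2 = 1"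
    using orth by (simp_all add: mat22_eq_iff matrix_mult_22 transpose_def mat_def)
  have 2: "A$1$1 * A$2$2 - A$1$2 * A$2$1 = 1"
    using det by (simp add: det_2)
  have "(A$1$1 - A$2$2)\<^sup>2 + (A$1$2 + A$2$1)\<^sup>2 = 0"
    using 1 2 by (simp add: power2_eq_square algebra_simps)
  then have 3: "A$1$1 = A$2$2" "A$2$1 = - A$1$2"
    by (auto simp: sum_power2_eq_zero_iff)
  have "(A$2$2)\<^sup>2 + (A$1$2)\<^sup>2 = 1"
    using 2 3 by (simp add: power2_eq_square)
  then obtain \<theta> where "A$2$2 = cos \<theta>" "A$1$2 = sin \<theta>"
    using sincos_total_2pi by metis
  then show "A \<in> range SO2_exp"
    using 3 by (auto simp: mat22_eq_iff intro!: exI[of _ \<theta>])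
next
  fix A assume "A \<in> range SO2_exp"
  then obtain \<theta> where A: "A = SO2_exp \<theta>" by auto
  have "cos \<theta> * cos \<theta> + sin \<theta> * sin \<theta> = 1"
    using sin_cos_squared_add2[of \<theta>] by (simp add: power2_eq_square)
  then show "A \<in> SO2"
    by (auto simp: A SO2_def rotation_matrix_def orthogonal_matrix mat22_eq_iff matrix_mult_22
        transpose_def mat_def det_2 algebra_simps)
qed

text \<open>The eigenvalues of a symmetric matrix of determinant 1 have the same sign, which the trace
  detects.\<close>

lemma sym_pos_def_22:
  fixes S :: "real^2^2"
  assumes "det S = 1"
  shows "sym_pos_def S \<longleftrightarrow> S$1$2 = S$2$1 \<and> S$1$1 + S$2$2 > 0"
proof -
  have sym: "transpose S = S \<longleftrightarrow> S$1$2 = S$2$1"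
    by (auto simp: mat22_eq_iff transpose_def)
  have quad: "x \<bullet> (S *v x) = S$1$1 * (x$1)\<^sup>2 + (S$1$2 + S$2$1) * (x$1 * x$2) + S$2$2 * (x$2)\<^sup>2" for x
    by (simp add: inner_vec_def matrix_vector_mult_def sum_2 power2_eq_square algebra_simps)
  have d: "S$1$1 * S$2$2 = 1 + S$1$2 * S$2$1" using assms by (simp add: det_2)
  show ?thesis
  proof
    assume S: "sym_pos_def S"
    then have "S$1$2 = S$2$1" using sym by (simp add: sym_pos_def_def)
    moreover have "x \<bullet> (S *v x) > 0" if "x \<noteq> 0" for x
      using S that by (simp add: sym_pos_def_def)
    from this[of "vector [1, 0]"] this[of "vector [0, 1]"]
    have "S$1$1 > 0" "S$2$2 > 0" by (simp_all add: quad vec_eq_iff forall_2)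
    ultimately show "S$1$2 = S$2$1 \<and> S$1$1 + S$2$2 > 0" by simp
  next
    assume R: "S$1$2 = S$2$1 \<and> S$1$1 + S$2$2 > 0"
    then have "S$1$1 * S$2$2 = 1 + (S$1$2)\<^sup>2" using d by (simp add: power2_eq_square)
    then have "S$1$1 * S$2$2 > 0" by (smt (verit) zero_le_power2)
    then have pos: "S$1$1 > 0"
      using R by (smt (verit) mult_neg_neg zero_less_mult_iff)
    have "x \<bullet> (S *v x) > 0" if "x \<noteq> 0" for x :: "real^2"
    proof -
      (* completing the square *)
      have "S$1$1 * (x \<bullet> (S *v x)) = (S$1$1 * x$1 + S$1$2 * x$2)\<^sup>2 + (S$1$1 * S$2$2 - S$1$2 * S$1$2) * (x$2)\<^sup>2"
        using R by (simp add: quad power2_eq_square algebra_simps)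
      also have "S$1$1 * S$2$2 - S$1$2 * S$1$2 = 1" using d R by simp
      also have "(S$1$1 * x$1 + S$1$2 * x$2)\<^sup>2 + 1 * (x$2)\<^sup>2 > 0"
      proof (cases "x$2 = 0")
        case True
        then have "x$1 \<noteq> 0" using that by (auto simp: vec_eq_iff forall_2)
        then show ?thesis using True pos by simp
      next
        case False
        then show ?thesis by (simp add: add_nonneg_pos)
      qed
      finally show ?thesis using pos by (simp add: zero_less_mult_iff)
    qed
    then show "sym_pos_def S" using R sym by (simp add: sym_pos_def_def)
  qed
qed

lemma rotation_part_SO2_exp_mult:
  "rotation_part (SO2_exp \<theta> ** S) = cis \<theta> * rotation_part S"
  by (simp add: rotation_part_def complex_eq_iff matrix_mult_22 algebra_simps)

lemma SO2_exp_mult_minus: "SO2_exp \<theta> ** (SO2_exp (- \<theta>) ** A) = A"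
proof -
  have 1: "cos \<theta> * cos \<theta> + sin \<theta> * sin \<theta> = 1"
    using sin_cos_squared_add2[of \<theta>] by (simp add: power2_eq_square)
  have "SO2_exp \<theta> ** SO2_exp (- \<theta>) = mat 1"
    using 1 by (simp add: mat22_eq_iff matrix_mult_22 mat_def algebra_simps)
  then show ?thesis by (simp add: matrix_mul_assoc)
qed

lemma det_SO2_exp [simp]: "det (SO2_exp \<theta>) = 1"
  using sin_cos_squared_add2[of \<theta>] by (simp add: det_2 power2_eq_square)

lemma SO2_exp_cong: "cis \<theta> = cis \<phi> \<Longrightarrow> SO2_exp \<theta> = SO2_exp \<phi>"
  by (simp add: complex_eq_iff mat22_eq_iff)

text \<open>Multiplying by the inverse rotation leaves a matrix with positive real \<open>rotation_part\<close>, that is,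
  a symmetric one with positive trace. With determinant 1, that is the same as being positive definite,
  which gives both existence and uniqueness of the rotation.\<close>

lemma polar_rotation_eq:
  assumes A: "A \<in> SL2" and r: "r > 0" and k: "rotation_part A = of_real r * cis \<theta>"
  shows "polar_rotation A = SO2_exp \<theta>"
  unfolding polar_rotation_def
proof (rule the_equality)
  define S where "S = SO2_exp (- \<theta>) ** A"
  have "rotation_part S = of_real r"
    by (simp add: S_def rotation_part_SO2_exp_mult k cis_mult)
  moreover have "det S = 1" using A by (simp add: S_def det_mul SL2_def)
  ultimately have "sym_pos_def S"
    using r by (simp add: sym_pos_def_22 rotation_part_def complex_eq_iff)
  moreover have "A = SO2_exp \<theta> ** S"
    by (simp add: S_def SO2_exp_mult_minus)
  ultimately show "SO2_exp \<theta> \<in> SO2 \<and> (\<exists>S. sym_pos_def S \<and> A = SO2_exp \<theta> ** S)"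
    by (auto simp: SO2_eq_range)
next
  fix R assume "R \<in> SO2 \<and> (\<exists>S. sym_pos_def S \<and> A = R ** S)"
  then obtain S \<phi> where S: "sym_pos_def S" "A = SO2_exp \<phi> ** S" "R = SO2_exp \<phi>"
    by (auto simp: SO2_eq_range)
  have "det S = 1" using A S(2) by (simp add: det_mul SL2_def)
  then have "S$1$2 = S$2$1" "S$1$1 + S$2$2 > 0"
    using S(1) by (simp_all add: sym_pos_def_22)
  then have "rotation_part S = of_real (S$1$1 + S$2$2)"
    by (simp add: rotation_part_def complex_eq_iff)
  then have eq: "of_real (S$1$1 + S$2$2) * cis \<phi> = of_real r * cis \<theta>"
    using k S(2) by (simp only: rotation_part_SO2_exp_mult mult.commute)
  have "cmod (of_real (S$1$1 + S$2$2) * cis \<phi>) = cmod (of_real r * cis \<theta>)"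
    by (simp only: eq)
  then have "S$1$1 + S$2$2 = r"
    using r \<open>S$1$1 + S$2$2 > 0\<close> by (simp only: norm_mult norm_cis norm_of_real mult_1_right abs_of_pos)
  then have "of_real r * cis \<phi> = of_real r * cis \<theta>" using eq by (simp only:)
  then have "cis \<phi> = cis \<theta>" using r by simp
  then show "R = SO2_exp \<theta>"
    unfolding S(3) by (rule SO2_exp_cong)
qed


section \<open>Unit tangent vectors in the disc model\<close>

text \<open>The derivative \<open>2 \<i> / (z + \<i>)\<^sup>2\<close> of the Cayley transform, applied to \<open>v\<close> and multiplied by the
  constant \<open>\<i> / 2\<close>, which does not affect changes of the argument.\<close>

definition disc_vector :: "complex \<times> complex \<Rightarrow> complex" where
  "disc_vector = (\<lambda>(z, v). - v / (z + \<i>)\<^sup>2)"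

text \<open>The unit vector at \<open>z\<close> whose image under \<open>disc_vector\<close> has argument \<open>\<psi>\<close>.\<close>

definition frame_vector :: "complex \<times> real \<Rightarrow> complex \<times> complex" where
  "frame_vector = (\<lambda>(z, \<psi>).
     (z, - of_real (Im z) * cis \<psi> * ((z + \<i>) / of_real (cmod (z + \<i>)))\<^sup>2))"

lemma upper_half_plane_plus_i: "z \<in> upper_half_plane \<Longrightarrow> z + \<i> \<noteq> 0"
  by (auto simp: upper_half_plane_def complex_eq_iff)

lemma convex_upper_half_plane: "convex upper_half_plane"
  using convex_halfspace_Im_gt[of 0] by (simp add: upper_half_plane_def)

lemma disc_vector_nonzero: "p \<in> UT \<Longrightarrow> disc_vector p \<noteq> 0"
  using upper_half_plane_plus_i by (fastforce simp: UT_def disc_vector_def)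

lemma continuous_on_disc_vector: "continuous_on UT disc_vector"
  unfolding disc_vector_def case_prod_unfold
  using upper_half_plane_plus_i by (fastforce simp: UT_def intro!: continuous_intros)

lemma frame_vector_in_UT: "z \<in> upper_half_plane \<Longrightarrow> frame_vector (z, \<psi>) \<in> UT"
  using upper_half_plane_plus_i[of z]
  by (auto simp: UT_def frame_vector_def norm_mult norm_divide norm_power upper_half_plane_def)

lemma frame_vector_eqI:
  assumes "(z, v) \<in> UT" "disc_vector (z, v) = of_real r * cis \<psi>" "r > 0"
  shows "(z, v) = frame_vector (z, \<psi>)"
proof -
  have "z \<in> upper_half_plane" and v: "cmod v = Im z"
    using assms(1) by (auto simp: UT_def upper_half_plane_def divide_eq_eq)
  then have z: "z + \<i> \<noteq> 0" by (intro upper_half_plane_plus_i)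
  then have "v = - (disc_vector (z, v) * (z + \<i>)\<^sup>2)"
    by (simp add: disc_vector_def)
  then have v_eq: "v = - (of_real r * cis \<psi> * (z + \<i>)\<^sup>2)"
    by (simp only: assms(2))
  have "Im z = r * (cmod (z + \<i>))\<^sup>2"
    using v assms(3) by (simp add: v_eq norm_mult norm_power)
  then show ?thesis
    using z by (simp add: frame_vector_def v_eq power_divide)
qed

lemma continuous_on_frame_vector: "continuous_on (upper_half_plane \<times> UNIV) frame_vector"
  unfolding frame_vector_def case_prod_unfold
  using upper_half_plane_plus_i by (fastforce intro!: continuous_intros)


section \<open>The action on the point \<open>\<i>\<close>\<close>

text \<open>The complex number \<open>c \<i> + d\<close>.\<close>

definition denominator_i :: "real^2^2 \<Rightarrow> complex" where
  "denominator_i A = Complex (A$2$2) (A$2$1)"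

lemma SL2_entries: "A \<in> SL2 \<longleftrightarrow> A$1$1 * A$2$2 - A$1$2 * A$2$1 = 1"
  by (simp add: SL2_def det_2)

lemma minus_in_SL2 [simp]: "- A \<in> SL2 \<longleftrightarrow> A \<in> SL2"
  by (simp add: SL2_entries)

lemma mat_1_in_SL2 [simp]: "mat 1 \<in> SL2"
  by (simp add: SL2_def)

lemma denominator_i_nonzero: "A \<in> SL2 \<Longrightarrow> denominator_i A \<noteq> 0"
  by (auto simp: denominator_i_def SL2_entries complex_eq_iff)

lemma mobius_i: "mobius A \<i> = Complex (A$1$2) (A$1$1) / denominator_i A"
  by (simp add: mobius_def denominator_i_def Complex_eq add.commute mult.commute)

text \<open>This identity ties the action on the half plane to the polar decomposition.\<close>

lemma mobius_i_plus_i: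
  assumes "A \<in> SL2"
  shows "mobius A \<i> + \<i> = \<i> * cnj (rotation_part A) / denominator_i A"
proof -
  have "mobius A \<i> + \<i> = (Complex (A$1$2) (A$1$1) + \<i> * denominator_i A) / denominator_i A"
    using denominator_i_nonzero[OF assms] by (simp add: mobius_i add_divide_distrib)
  also have "Complex (A$1$2) (A$1$1) + \<i> * denominator_i A = \<i> * cnj (rotation_part A)"
    by (simp add: rotation_part_def denominator_i_def complex_eq_iff)
  finally show ?thesis .
qed

lemma Im_mobius_i:
  assumes "A \<in> SL2"
  shows "Im (mobius A \<i>) = 1 / (cmod (denominator_i A))\<^sup>2"
  using assms
  by (simp add: mobius_i Im_divide denominator_i_def cmod_power2 SL2_entries add.commute)

lemma mobius_i_in_upper_half_plane: "A \<in> SL2 \<Longrightarrow> mobius A \<i> \<in> upper_half_plane"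
  using denominator_i_nonzero by (simp add: upper_half_plane_def Im_mobius_i)

lemma deriv_mobius_i:
  assumes "A \<in> SL2"
  shows "deriv (mobius A) \<i> = 1 / (denominator_i A)\<^sup>2"
proof (rule DERIV_imp_deriv)
  have nz: "of_real (A$2$1) * \<i> + of_real (A$2$2) \<noteq> 0"
    using denominator_i_nonzero[OF assms] by (simp add: denominator_i_def complex_eq_iff)
  have det: "complex_of_real (A$1$1) * of_real (A$2$2) - of_real (A$1$2) * of_real (A$2$1) = 1"
    using assms unfolding SL2_entries by (metis of_real_1 of_real_diff of_real_mult)
  have "(mobius A has_field_derivative
     (of_real (A$1$1) * (of_real (A$2$1) * \<i> + of_real (A$2$2)) -
      (of_real (A$1$1) * \<i> + of_real (A$1$2)) * of_real (A$2$1)) /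
     (of_real (A$2$1) * \<i> + of_real (A$2$2))\<^sup>2) (at \<i>)"
    unfolding mobius_def using nz by (auto intro!: derivative_eq_intros simp: power2_eq_square)
  also have "of_real (A$1$1) * (of_real (A$2$1) * \<i> + of_real (A$2$2)) -
      (of_real (A$1$1) * \<i> + of_real (A$1$2)) * of_real (A$2$1) = (1 :: complex)"
    using det by (simp add: algebra_simps)
  also have "of_real (A$2$1) * \<i> + of_real (A$2$2) = denominator_i A"
    by (simp add: denominator_i_def complex_eq_iff)
  finally show "(mobius A has_field_derivative 1 / (denominator_i A)\<^sup>2) (at \<i>)" .
qed

lemma mobius_mat_1: "mobius (mat 1) z = z"
  by (simp add: mobius_def mat_def)

lemma act_abs_psl2: "A \<in> SL2 \<Longrightarrow> act (abs_psl2 A) = mobius A"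
  by (simp add: act.abs_eq psl2_rel_def)

lemma act_identity_i: "act (abs_psl2 (mat 1)) \<i> = \<i>"
  by (simp add: act_abs_psl2 mobius_mat_1)

lemma abs_psl2_eq_iff:
  "A \<in> SL2 \<Longrightarrow> B \<in> SL2 \<Longrightarrow> abs_psl2 A = abs_psl2 B \<longleftrightarrow> A = B \<or> A = - B"
  using Quotient3_rel[OF Quotient3_psl2, of A B] by (auto simp: psl2_rel_def)

lemma psl2_cases:
  obtains A where "A \<in> SL2" "g = abs_psl2 A"
proof (rule that)
  show "rep_psl2 g \<in> SL2"
    using Quotient3_rep_reflp[OF Quotient3_psl2, of g] by (simp add: psl2_rel_def)
  show "g = abs_psl2 (rep_psl2 g)"
    by (simp add: Quotient3_abs_rep[OF Quotient3_psl2])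
qed

lemma tangent_map_abs_psl2:
  "A \<in> SL2 \<Longrightarrow> tangent_map (abs_psl2 A) (\<i>, u) = (mobius A \<i>, u / (denominator_i A)\<^sup>2)"
  by (simp add: tangent_map_def act_abs_psl2 deriv_mobius_i)

lemma tangent_map_in_UT:
  assumes "cmod u = 1"
  shows "tangent_map g (\<i>, u) \<in> UT"
proof (cases g rule: psl2_cases)
  case (1 A)
  then show ?thesis
    using assms mobius_i_in_upper_half_plane[of A] denominator_i_nonzero[of A]
    by (simp add: tangent_map_abs_psl2 UT_def norm_divide norm_power Im_mobius_i)
qed

text \<open>The heart of the matter. The tangent vector is \<open>u / (c \<i> + d)\<^sup>2\<close>, and the denominator cancels
  against the one in \<open>mobius_i_plus_i\<close>, leaving \<open>u / (cnj k)\<^sup>2\<close> for \<open>k = rotation_part A\<close>. The square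
  is the origin of the factor 2 between the two angles.\<close>

lemma disc_vector_tangent_map:
  assumes A: "A \<in> SL2" and r: "r > 0" and k: "rotation_part A = of_real r * cis \<theta>"
  shows "disc_vector (tangent_map (abs_psl2 A) (\<i>, u)) = of_real (1 / r\<^sup>2) * (cis (2 * \<theta>) * u)"
proof -
  have "disc_vector (tangent_map (abs_psl2 A) (\<i>, u)) = u / (cnj (rotation_part A))\<^sup>2"
    using denominator_i_nonzero[OF A] rotation_part_nonzero[OF A]
    by (simp add: tangent_map_abs_psl2 A disc_vector_def mobius_i_plus_i power_divide power_mult_distrib)
  also have "\<dots> = of_real (1 / r\<^sup>2) * (u / (cis (- \<theta>))\<^sup>2)"
    by (simp add: k cis_cnj power_mult_distrib)
  also have "(cis (- \<theta>))\<^sup>2 = inverse (cis (2 * \<theta>))"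
    by (simp add: cis_inverse power2_eq_square cis_mult)
  also have "u / inverse (cis (2 * \<theta>)) = cis (2 * \<theta>) * u"
    by (simp add: divide_inverse mult.commute)
  finally show ?thesis .
qed

lemma continuous_on_abs_psl2: "continuous_on SL2 abs_psl2"
  unfolding continuous_on_open_invariant
proof (intro allI impI)
  fix U :: "psl2 set" assume "open U"
  then obtain T where "open T" "{A \<in> SL2. abs_psl2 A \<in> U} = SL2 \<inter> T"
    unfolding open_psl2_def by (auto simp: openin_open)
  then show "\<exists>T. open T \<and> T \<inter> SL2 = abs_psl2 -` U \<inter> SL2"
    by (intro exI[of _ T]) auto
qed

text \<open>The universal property of the quotient topology.\<close>

lemma continuous_on_psl2:
  fixes f :: "psl2 \<Rightarrow> 'b::topological_space"
  assumes "continuous_on SL2 (f \<circ> abs_psl2)"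
  shows "continuous_on UNIV f"
  unfolding continuous_on_open_vimage[OF open_UNIV]
proof (intro allI impI)
  fix U :: "'b set" assume "open U"
  then obtain T where "open T" "T \<inter> SL2 = (f \<circ> abs_psl2) -` U \<inter> SL2"
    using assms unfolding continuous_on_open_invariant by blast
  then have "{A \<in> SL2. abs_psl2 A \<in> f -` U} = SL2 \<inter> T" by auto
  then show "open (f -` U \<inter> UNIV)"
    using \<open>open T\<close> unfolding open_psl2_def openin_open by auto
qed

lemma continuous_on_tangent_map: "continuous_on UNIV (\<lambda>g. tangent_map g (\<i>, u))"
proof (rule continuous_on_psl2)
  have "continuous_on SL2 (\<lambda>A. (Complex (A$1$2) (A$1$1) / denominator_i A, u / (denominator_i A)\<^sup>2))"
    using denominator_i_nonzero unfolding denominator_i_def Complex_eq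
    by (auto intro!: continuous_intros)
  then show "continuous_on SL2 ((\<lambda>g. tangent_map g (\<i>, u)) \<circ> abs_psl2)"
    by (rule continuous_on_eq) (simp add: tangent_map_abs_psl2 mobius_i)
qed


lemma fst_tangent_map [simp]: "fst (tangent_map g (z, u)) = act g z"
  by (simp add: tangent_map_def)

lemma act_i_in_upper_half_plane: "act g \<i> \<in> upper_half_plane"
  using tangent_map_in_UT[of 1 g] by (simp add: UT_def tangent_map_def)

lemma path_tangent_map: "path g \<Longrightarrow> path (\<lambda>t. tangent_map (g t) (\<i>, u))"
  using path_continuous_image[OF _ continuous_on_subset[OF continuous_on_tangent_map subset_UNIV]]
  by (auto simp: o_def)

lemma path_act_i:
  assumes "path g"
  shows "path (\<lambda>t. act (g t) \<i>)"
  using continuous_on_fst[OF path_tangent_map[OF assms, unfolded path_def]]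
  by (simp add: path_def)


section \<open>Polar coordinates on \<open>SL\<^sub>2(\<real>)\<close>\<close>

text \<open>The matrix of determinant 1 that sends \<open>\<i>\<close> to \<open>z\<close> and has rotation factor \<open>exp \<theta>\<close>. Here \<open>j\<close> is
  \<open>c \<i> + d\<close>: its modulus is forced by \<open>Im z = 1 / \<bar>j\<bar>\<^sup>2\<close> and its argument by \<open>mobius_i_plus_i\<close>. The upper
  row is then read off from \<open>a \<i> + b = z j\<close>.\<close>

definition polar_matrix :: "complex \<times> real \<Rightarrow> real^2^2" where
  "polar_matrix = (\<lambda>(z, \<theta>).
     let j = \<i> * cis (- \<theta>) * of_real (cmod (z + \<i>)) / ((z + \<i>) * of_real (sqrt (Im z)))
     in vector [vector [Im (z * j), Re (z * j)], vector [Im j, Re j]])"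

lemma polar_matrix_denominator:
  "denominator_i (polar_matrix (z, \<theta>)) =
     \<i> * cis (- \<theta>) * of_real (cmod (z + \<i>)) / ((z + \<i>) * of_real (sqrt (Im z)))"
  by (simp add: denominator_i_def polar_matrix_def Let_def)

lemma polar_matrix_numerator:
  "Complex (polar_matrix (z, \<theta>) $ 1 $ 2) (polar_matrix (z, \<theta>) $ 1 $ 1) =
     z * denominator_i (polar_matrix (z, \<theta>))"
proof -
  obtain j where j: "polar_matrix (z, \<theta>) = vector [vector [Im (z * j), Re (z * j)], vector [Im j, Re j]]"
    by (simp add: polar_matrix_def Let_def)
  show ?thesis unfolding j denominator_i_def by (simp add: complex_eq_iff)
qed

lemma matrix_eq_by_action:
  assumes "Complex (A$1$2) (A$1$1) = Complex (B$1$2) (B$1$1)" "denominator_i A = denominator_i B"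
  shows "A = B"
  using assms by (simp add: denominator_i_def mat22_eq_iff)

text \<open>The determinant is the imaginary part of \<open>(a \<i> + b) * cnj (c \<i> + d) = z \<bar>j\<bar>\<^sup>2\<close>.\<close>

lemma polar_matrix_in_SL2:
  assumes z: "z \<in> upper_half_plane"
  shows "polar_matrix (z, \<theta>) \<in> SL2"
proof -
  let ?A = "polar_matrix (z, \<theta>)"
  have nz: "z + \<i> \<noteq> 0" "Im z > 0"
    using z upper_half_plane_plus_i by (auto simp: upper_half_plane_def)
  have norm: "(cmod (denominator_i ?A))\<^sup>2 = 1 / Im z"
    using nz by (simp add: polar_matrix_denominator norm_mult norm_divide power_divide)
  have "?A$1$1 * ?A$2$2 - ?A$1$2 * ?A$2$1 =
      Im (Complex (?A$1$2) (?A$1$1) * cnj (denominator_i ?A))"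
    by (simp add: denominator_i_def)
  also have "\<dots> = Im (z * of_real ((cmod (denominator_i ?A))\<^sup>2))"
    by (simp only: polar_matrix_numerator mult.assoc complex_norm_square)
  also have "\<dots> = 1"
    using nz unfolding norm by simp
  finally show ?thesis by (simp add: SL2_entries)
qed

text \<open>By \<open>mobius_i_plus_i\<close>, the image of \<open>\<i>\<close> and the rotation factor determine \<open>c \<i> + d\<close>, and with it
  the matrix.\<close>

lemma polar_matrix_eqI:
  assumes A: "A \<in> SL2" and r: "r > 0" and k: "rotation_part A = of_real r * cis \<theta>"
  shows "A = polar_matrix (mobius A \<i>, \<theta>)"
proof (rule matrix_eq_by_action)
  let ?z = "mobius A \<i>"
  have z: "?z + \<i> \<noteq> 0"
    using mobius_i_in_upper_half_plane[OF A] upper_half_plane_plus_i by blast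
  have "cmod (?z + \<i>) = r / cmod (denominator_i A)"
    using r by (simp add: mobius_i_plus_i[OF A] k norm_mult norm_divide)
  then have r_eq: "r = cmod (?z + \<i>) / sqrt (Im ?z)"
    using denominator_i_nonzero[OF A] by (simp add: Im_mobius_i[OF A] real_sqrt_divide field_simps)
  have "denominator_i A = \<i> * cnj (rotation_part A) / (?z + \<i>)"
    using z denominator_i_nonzero[OF A] mobius_i_plus_i[OF A] by (simp add: field_simps)
  then show d: "denominator_i A = denominator_i (polar_matrix (?z, \<theta>))"
    by (simp add: polar_matrix_denominator k r_eq cis_cnj field_simps)
  show "Complex (A$1$2) (A$1$1) =
      Complex (polar_matrix (?z, \<theta>) $ 1 $ 2) (polar_matrix (?z, \<theta>) $ 1 $ 1)"
    unfolding polar_matrix_numerator d [symmetric]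
    using denominator_i_nonzero[OF A] by (simp add: mobius_i)
qed

lemma continuous_on_polar_matrix: "continuous_on (upper_half_plane \<times> UNIV) polar_matrix"
  unfolding polar_matrix_def Let_def case_prod_unfold
  by (intro continuous_on_mat22;
      use upper_half_plane_plus_i in \<open>fastforce simp: upper_half_plane_def intro!: continuous_intros\<close>)


section \<open>Geodesics through \<open>\<i>\<close>\<close>

text \<open>The inverse Cayley transform, from the unit disc to the upper half plane.\<close>

definition cayley_inverse :: "complex \<Rightarrow> complex" where
  "cayley_inverse w = \<i> * (1 + w) / (1 - w)"

text \<open>The point at distance \<open>x\<close> from the centre in the direction \<open>e\<close> of the disc: hyperbolic distance
  \<open>x\<close> from the centre is Euclidean distance \<open>tanh (x / 2)\<close>.\<close>

definition radial_point :: "complex \<Rightarrow> real \<Rightarrow> complex" where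
  "radial_point e x = cayley_inverse (of_real (tanh (x / 2)) * e)"

lemma one_minus_nonzero: "cmod w < 1 \<Longrightarrow> 1 - w \<noteq> 0"
  by auto

lemma Im_cayley_inverse:
  assumes "cmod w < 1"
  shows "Im (cayley_inverse w) = (1 - (cmod w)\<^sup>2) / (cmod (1 - w))\<^sup>2"
proof -
  have "cayley_inverse w = \<i> * (1 + w) * cnj (1 - w) / of_real ((cmod (1 - w))\<^sup>2)"
    unfolding cayley_inverse_def by (subst complex_div_cnj) simp
  also have "Im \<dots> = Re ((1 + w) * cnj (1 - w)) / (cmod (1 - w))\<^sup>2"
    by (simp only: Im_divide_of_real mult.assoc) simp
  also have "Re ((1 + w) * cnj (1 - w)) = 1 - (cmod w)\<^sup>2"
    by (simp add: cmod_power2) (simp add: power2_eq_square algebra_simps)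
  finally show ?thesis .
qed

lemma cayley_inverse_in_upper_half_plane:
  "cmod w < 1 \<Longrightarrow> cayley_inverse w \<in> upper_half_plane"
  using one_minus_nonzero[of w] abs_square_less_1[of "cmod w"]
  by (simp add: upper_half_plane_def Im_cayley_inverse)

lemma hyp_dist_cayley_inverse:
  assumes w: "cmod w < 1" and v: "cmod v < 1"
  shows "hyp_dist (cayley_inverse w) (cayley_inverse v) =
    arcosh (1 + 2 * (cmod (w - v))\<^sup>2 / ((1 - (cmod w)\<^sup>2) * (1 - (cmod v)\<^sup>2)))"
proof -
  note nz = one_minus_nonzero[OF w] one_minus_nonzero[OF v]
  have "cayley_inverse w - cayley_inverse v = 2 * \<i> * (w - v) / ((1 - w) * (1 - v))"
    using nz by (simp add: cayley_inverse_def divide_simps) (simp add: algebra_simps)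
  then have num: "(cmod (cayley_inverse w - cayley_inverse v))\<^sup>2 =
      4 * (cmod (w - v))\<^sup>2 / ((cmod (1 - w))\<^sup>2 * (cmod (1 - v))\<^sup>2)"
    by (simp add: norm_mult norm_divide power_divide power_mult_distrib)
  have cancel: "4 * q / (a * b) / (2 * (p / a) * (r / b)) = 2 * q / (p * r)"
    if "a \<noteq> 0" "b \<noteq> 0" for a b p q r :: real
    using that by (simp add: divide_simps)
  have "(cmod (cayley_inverse w - cayley_inverse v))\<^sup>2 /
      (2 * Im (cayley_inverse w) * Im (cayley_inverse v)) =
      2 * (cmod (w - v))\<^sup>2 / ((1 - (cmod w)\<^sup>2) * (1 - (cmod v)\<^sup>2))"
    unfolding num Im_cayley_inverse[OF w] Im_cayley_inverse[OF v]
    by (rule cancel) (use nz in auto)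
  then show ?thesis
    by (simp only: hyp_dist_def)
qed

lemma cosh_diff_tanh:
  fixes x y :: real
  shows "1 + 2 * (tanh (x / 2) - tanh (y / 2))\<^sup>2 / ((1 - (tanh (x / 2))\<^sup>2) * (1 - (tanh (y / 2))\<^sup>2))
     = cosh (x - y)"
proof -
  define a b where "a = x / 2" and "b = y / 2"
  have sech: "1 - (tanh t)\<^sup>2 = 1 / (cosh t)\<^sup>2" for t :: real
  proof -
    have "1 - (tanh t)\<^sup>2 = ((cosh t)\<^sup>2 - (sinh t)\<^sup>2) / (cosh t)\<^sup>2"
      by (simp add: tanh_def power_divide diff_divide_distrib)
    then show ?thesis by (simp only: hyperbolic_pythagoras)
  qed
  have "tanh a - tanh b = sinh (a - b) / (cosh a * cosh b)"
    by (simp add: tanh_def sinh_diff field_simps)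
  then have "1 + 2 * (tanh a - tanh b)\<^sup>2 / ((1 - (tanh a)\<^sup>2) * (1 - (tanh b)\<^sup>2)) = 1 + 2 * (sinh (a - b))\<^sup>2"
    by (simp add: sech power_divide power_mult_distrib)
  also have "\<dots> = cosh (2 * (a - b))"
    by (simp only: cosh_double cosh_square_eq)
  finally show ?thesis by (simp add: a_def b_def)
qed

lemma norm_radial: "cmod e = 1 \<Longrightarrow> cmod (of_real (tanh x) * e) = \<bar>tanh x\<bar>"
  by (simp add: norm_mult)

lemma norm_radial_less_1: "cmod e = 1 \<Longrightarrow> cmod (of_real (tanh x) * e) < 1"
  using tanh_real_bounds[of x] by (simp add: norm_radial abs_less_iff)

lemma radial_point_in_upper_half_plane: "cmod e = 1 \<Longrightarrow> radial_point e x \<in> upper_half_plane"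
  unfolding radial_point_def by (intro cayley_inverse_in_upper_half_plane norm_radial_less_1)

lemma radial_point_0 [simp]: "radial_point e 0 = \<i>"
  by (simp add: radial_point_def cayley_inverse_def)

lemma hyp_dist_radial_point:
  assumes "cmod e = 1"
  shows "hyp_dist (radial_point e x) (radial_point e y) = \<bar>x - y\<bar>"
proof -
  have "hyp_dist (radial_point e x) (radial_point e y) = arcosh (cosh (x - y))"
    unfolding radial_point_def cosh_diff_tanh [symmetric]
      hyp_dist_cayley_inverse[OF norm_radial_less_1 norm_radial_less_1, OF assms assms]
    by (simp add: left_diff_distrib [symmetric] of_real_diff [symmetric] norm_radial norm_mult assms
        del: of_real_diff)
  also have "\<dots> = arcosh (cosh \<bar>x - y\<bar>)" by simp
  also have "\<dots> = \<bar>x - y\<bar>" by (rule arcosh_cosh_real) simp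
  finally show ?thesis .
qed

lemma radial_point_cases:
  assumes z: "z \<in> upper_half_plane"
  obtains e x where "cmod e = 1" "x \<ge> 0" "z = radial_point e x"
proof -
  define w where "w = (z - \<i>) / (z + \<i>)"
  have nz: "z + \<i> \<noteq> 0" using z by (rule upper_half_plane_plus_i)
  have "(cmod (z - \<i>))\<^sup>2 < (cmod (z + \<i>))\<^sup>2"
    using z by (simp add: cmod_power2 upper_half_plane_def) (simp add: power2_eq_square algebra_simps)
  then have w1: "cmod w < 1"
    using nz by (simp add: w_def norm_divide power_less_imp_less_base)
  have "1 - w = 2 * \<i> / (z + \<i>)" "1 + w = 2 * z / (z + \<i>)"
    using nz by (simp_all add: w_def field_simps)
  then have z_eq: "z = cayley_inverse w"
    using nz by (simp add: cayley_inverse_def)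
  define e where "e = (if w = 0 then 1 else sgn w)"
  define x where "x = 2 * artanh (cmod w)"
  have tanh: "tanh (x / 2) = cmod w"
  proof -
    have "exp (- 2 * artanh (cmod w)) = inverse ((1 + cmod w) / (1 - cmod w))"
      using w1 by (simp add: artanh_def exp_minus add_pos_nonneg)
    moreover have p: "1 + cmod w > 0" by (simp add: add_pos_nonneg)
    moreover have "1 - (1 - cmod w) / (1 + cmod w) = 2 * cmod w / (1 + cmod w)"
      "1 + (1 - cmod w) / (1 + cmod w) = 2 / (1 + cmod w)"
      using p by (simp_all add: add_divide_distrib [symmetric] diff_divide_distrib [symmetric] field_simps)
    ultimately show ?thesis
      by (simp add: x_def tanh_real_altdef)
  qed
  show thesis
  proof (rule that)
    show "cmod e = 1" by (simp add: e_def norm_sgn)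
    have "tanh (x / 2) \<ge> 0" by (simp add: tanh)
    then show "x \<ge> 0" by simp
    have "of_real (cmod w) * e = w" by (simp add: e_def sgn_eq)
    then show "z = radial_point e x" by (simp add: radial_point_def tanh z_eq)
  qed
qed

text \<open>Once the moduli \<open>a\<close> and \<open>b\<close> of two points of the disc are given, their hyperbolic distance
  determines the Euclidean one, which is therefore \<open>b - a\<close>, as for points on a common radius. This is
  equality in the Euclidean triangle inequality, so the two points are on a common radius.\<close>

lemma radial_point_eq_if_hyp_dist:
  assumes e: "cmod e = 1" "cmod e' = 1" and x: "0 \<le> x" "x \<le> y"
    and dist: "hyp_dist (radial_point e' x) (radial_point e y) = y - x"
  shows "radial_point e' x = radial_point e x"
proof -
  define a b where "a = tanh (x / 2)" and "b = tanh (y / 2)"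
  have ab: "0 \<le> a" "a \<le> b" "b < 1"
    using x tanh_real_lt_1 by (simp_all add: a_def b_def)
  have pos: "(1 - a\<^sup>2) * (1 - b\<^sup>2) > 0"
    using ab by (intro mult_pos_pos) (auto simp: abs_square_less_1)
  define q where "q = cmod (of_real a * e' - of_real b * e)"
  have "arcosh (1 + 2 * q\<^sup>2 / ((1 - a\<^sup>2) * (1 - b\<^sup>2))) = y - x"
    using dist unfolding radial_point_def
      hyp_dist_cayley_inverse[OF norm_radial_less_1 norm_radial_less_1, OF e(2,1)]
    by (simp add: norm_mult e a_def b_def q_def)
  then have "cosh (y - x) = cosh (arcosh (1 + 2 * q\<^sup>2 / ((1 - a\<^sup>2) * (1 - b\<^sup>2))))"
    by simp
  also have "\<dots> = 1 + 2 * q\<^sup>2 / ((1 - a\<^sup>2) * (1 - b\<^sup>2))"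
    using pos by (intro cosh_arcosh_real) simp
  finally have "1 + 2 * q\<^sup>2 / ((1 - a\<^sup>2) * (1 - b\<^sup>2)) = 1 + 2 * (b - a)\<^sup>2 / ((1 - b\<^sup>2) * (1 - a\<^sup>2))"
    using cosh_diff_tanh[of y x] by (simp add: a_def b_def)
  then have "q\<^sup>2 = (b - a)\<^sup>2"
    using pos by (auto simp: mult.commute[of "1 - b\<^sup>2"])
  moreover have "q\<^sup>2 = a\<^sup>2 + b\<^sup>2 - 2 * a * b * Re (e' * cnj e)"
  proof -
    have "(Re e)\<^sup>2 + (Im e)\<^sup>2 = 1" "(Re e')\<^sup>2 + (Im e')\<^sup>2 = 1"
      using e by (simp_all flip: cmod_power2)
    moreover have "q\<^sup>2 = a\<^sup>2 * ((Re e')\<^sup>2 + (Im e')\<^sup>2) + b\<^sup>2 * ((Re e)\<^sup>2 + (Im e)\<^sup>2) - 2 * a * b * Re (e' * cnj e)"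
      by (simp add: q_def cmod_power2) (simp add: power2_eq_square algebra_simps)
    ultimately show ?thesis by simp
  qed
  ultimately have "a * b * (1 - Re (e' * cnj e)) = 0"
    by (simp add: power2_eq_square algebra_simps)
  (* b = 0 forces a = 0, and at the centre the direction does not matter *)
  then consider "a = 0" | "b = 0" | "Re (e' * cnj e) = 1" by auto
  then have disc_eq: "of_real a * e' = of_real a * e"
  proof cases
    case 3
    moreover have "cmod (e' * cnj e) = 1" by (simp add: norm_mult e)
    ultimately have "e' * cnj e = 1"
      using cmod_power2[of "e' * cnj e"] by (simp only: complex_eq_iff) simp
    moreover have "cnj e * e = 1"
      using complex_norm_square[of e] e by (simp add: mult.commute)
    then have "e' = e' * cnj e * e" by (simp add: mult.assoc)
    ultimately have "e' = e" by simp
    then show ?thesis by simp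
  qed (use ab in auto)
  show ?thesis
    by (simp only: radial_point_def disc_eq flip: a_def)
qed

text \<open>Each \<open>c t\<close> has distance \<open>t d\<close> from \<open>\<i>\<close> and \<open>(1 - t) d\<close> from the endpoint, so it lies on the radius
  towards the endpoint.\<close>

lemma geodesic_from_i:
  assumes "geodesic_from_to c \<i> w"
  obtains e d where "cmod e = 1" "d \<ge> 0" "\<And>t. t \<in> {0..1} \<Longrightarrow> c t = radial_point e (t * d)"
proof -
  have c: "\<And>t. t \<in> {0..1} \<Longrightarrow> c t \<in> upper_half_plane" "c 0 = \<i>" "c 1 = w"
    and dist: "\<And>s t. s \<in> {0..1} \<Longrightarrow> t \<in> {0..1} \<Longrightarrow> hyp_dist (c s) (c t) = \<bar>s - t\<bar> * hyp_dist \<i> w"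
    using assms by (auto simp: geodesic_from_to_def)
  have "w \<in> upper_half_plane" using c(1)[of 1] c(3) by simp
  then obtain e d where e: "cmod e = 1" and d: "d \<ge> 0" and w: "w = radial_point e d"
    by (rule radial_point_cases)
  have dw: "hyp_dist \<i> w = d"
    using hyp_dist_radial_point[OF e, of 0 d] d by (simp add: w)
  have "c t = radial_point e (t * d)" if t: "t \<in> {0..1}" for t
  proof -
    obtain e' x where e': "cmod e' = 1" and x: "x \<ge> 0" and ct: "c t = radial_point e' x"
      using c(1)[OF t] by (rule radial_point_cases)
    have "x = t * d"
      using hyp_dist_radial_point[OF e', of 0 x] dist[of 0 t] t x by (simp add: c(2) dw ct)
    moreover have "hyp_dist (radial_point e' x) (radial_point e d) = d - t * d"
    proof -
      have "hyp_dist (c t) (c 1) = (1 - t) * d"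
        using dist[of t 1] t by (simp add: dw)
      then show ?thesis by (simp add: c(3) w ct left_diff_distrib)
    qed
    moreover have "t * d \<le> d" using t d by (simp add: mult_left_le_one_le)
    ultimately show ?thesis
      using radial_point_eq_if_hyp_dist[OF e e', of x d] x ct by simp
  qed
  with e d show thesis by (rule that)
qed

lemma geodesic_from_i_exists:
  assumes "w \<in> upper_half_plane"
  obtains c where "geodesic_from_to c \<i> w"
proof -
  obtain e d where e: "cmod e = 1" and d: "d \<ge> 0" and w: "w = radial_point e d"
    using assms by (rule radial_point_cases)
  have "hyp_dist \<i> w = d"
    using hyp_dist_radial_point[OF e, of 0 d] d by (simp add: w)
  then have "geodesic_from_to (\<lambda>t. radial_point e (t * d)) \<i> w"
    using e d by (auto simp: geodesic_from_to_def radial_point_in_upper_half_plane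
        hyp_dist_radial_point w left_diff_distrib [symmetric] abs_mult)
  then show thesis by (rule that)
qed

lemma has_vector_derivative_radial_point:
  assumes e: "cmod e = 1"
  shows "((\<lambda>t. radial_point e (t * d)) has_vector_derivative
     \<i> * e * of_real (d * (1 - (tanh (t * d / 2))\<^sup>2)) / (1 - of_real (tanh (t * d / 2)) * e)\<^sup>2)
     (at t within S)"
proof -
  let ?w = "\<lambda>t. of_real (tanh (t * d / 2)) * e"
  have nz: "1 - ?w t \<noteq> 0"
    using norm_radial_less_1[OF e] by (rule one_minus_nonzero)
  have "((\<lambda>t. tanh (t * d / 2)) has_real_derivative (1 - (tanh (t * d / 2))\<^sup>2) * (d / 2)) (at t within S)"
    by (auto intro!: derivative_eq_intros)
  then have "(?w has_vector_derivative of_real ((1 - (tanh (t * d / 2))\<^sup>2) * (d / 2)) * e) (at t within S)"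
    by (intro has_vector_derivative_mult_left has_vector_derivative_of_real)
      (simp add: has_real_derivative_iff_has_vector_derivative)
  moreover have "(cayley_inverse has_field_derivative 2 * \<i> / (1 - ?w t)\<^sup>2) (at (?w t))"
    unfolding cayley_inverse_def using nz
    by (auto intro!: derivative_eq_intros simp: power2_eq_square algebra_simps)
  ultimately have deriv: "((cayley_inverse \<circ> ?w) has_vector_derivative
      of_real ((1 - (tanh (t * d / 2))\<^sup>2) * (d / 2)) * e * (2 * \<i> / (1 - ?w t)\<^sup>2)) (at t within S)"
    by (rule field_vector_diff_chain_within[OF _ has_field_derivative_at_within])
  have "of_real (a * (d / 2)) * e * (2 * \<i> / D) = \<i> * e * of_real (d * a) / D" for a D
    by (simp add: mult_ac)
  with deriv show ?thesis
    by (simp only: o_def radial_point_def)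
qed


lemma path_geodesic_from_i:
  assumes "geodesic_from_to c \<i> w"
  shows "path c"
proof -
  obtain e d where "cmod e = 1" and c: "\<And>t. t \<in> {0..1} \<Longrightarrow> c t = radial_point e (t * d)"
    using geodesic_from_i[OF assms] by metis
  then have "continuous_on {0..1} (\<lambda>t. radial_point e (t * d))"
    by (intro continuous_at_imp_continuous_on ballI)
      (rule has_vector_derivative_continuous[OF has_vector_derivative_radial_point])
  then show ?thesis
    unfolding path_def by (rule continuous_on_eq) (simp add: c)
qed

text \<open>Along a radius of the disc the velocity has the constant direction \<open>e\<close>; the extra factor \<open>\<i>\<close> in
  the proof is the constant \<open>\<i> / 2\<close> by which \<open>disc_vector\<close> differs from the derivative of the Cayley
  transform. The constant geodesic has to be treated apart, its reference field being constant by
  definition.\<close>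

lemma reference_field_argument:
  assumes geo: "geodesic_from_to c \<i> w" and ref: "reference_field c T"
  obtains \<tau> where "\<And>t. t \<in> {0..1} \<Longrightarrow> (c t, T t) \<in> UT"
    and "\<And>t. t \<in> {0..1} \<Longrightarrow> \<exists>r>0. disc_vector (c t, T t) = of_real r * cis \<tau>"
proof -
  obtain e d where e: "cmod e = 1" and d: "d \<ge> 0"
    and c: "\<And>t. t \<in> {0..1} \<Longrightarrow> c t = radial_point e (t * d)"
    using geodesic_from_i[OF geo] by metis
  show thesis
  proof (cases "d = 0")
    case True
    then have const: "\<forall>t\<in>{0..1}. c t = c 0" by (simp add: c)
    obtain u where u: "(c 0, u) \<in> UT" "\<forall>t\<in>{0..1}. T t = u"
      using ref unfolding reference_field_def if_P[OF const] by blast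
    define x where "x = disc_vector (c 0, u)"
    have "x \<noteq> 0" unfolding x_def using u(1) by (rule disc_vector_nonzero)
    then have "\<exists>r>0. x = of_real r * cis (Arg x)"
      by (intro exI[of _ "cmod x"]) (simp add: norm_times_cis_Arg)
    moreover have "(c t, T t) = (c 0, u)" if "t \<in> {0..1}" for t
      using const u(2) that by (simp only: prod.inject)
    ultimately show thesis
      using u(1) by (intro that[of "Arg x"]) (simp_all only: x_def)
  next
    case False
    have "hyp_dist (c 0) (c 1) = d"
      using hyp_dist_radial_point[OF e, of 0 d] d by (simp add: c)
    moreover have "hyp_dist (c 0) (c 0) = 0"
      using hyp_dist_radial_point[OF e, of 0 0] by (simp add: c)
    ultimately have "c 1 \<noteq> c 0" using False by metis
    moreover have "(1::real) \<in> {0..1}" by simp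
    ultimately have nonconst: "\<not> (\<forall>t\<in>{0..1}. c t = c 0)" by blast
    have *: "(c t, T t) \<in> UT \<and> (\<exists>r>0. disc_vector (c t, T t) = of_real r * cis (Arg (\<i> * e)))"
      if t: "t \<in> {0..1}" for t
    proof -
      define v where "v = vector_derivative c (at t within {0..1})"
      define q where "q = of_real (tanh (t * d / 2)) * e"
      define s where "s = d * (1 - (tanh (t * d / 2))\<^sup>2)"
      have q: "1 - q \<noteq> 0"
        unfolding q_def using norm_radial_less_1[OF e] by (rule one_minus_nonzero)
      have s: "s > 0"
        using d False tanh_real_bounds[of "t * d / 2"] by (simp add: s_def abs_square_less_1 abs_less_iff)
      have "(c has_vector_derivative \<i> * e * of_real s / (1 - q)\<^sup>2) (at t within {0..1})"
        unfolding s_def q_def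
        by (rule has_vector_derivative_transform[OF t _ has_vector_derivative_radial_point[OF e]])
          (simp add: c)
      then have v: "v = \<i> * e * of_real s / (1 - q)\<^sup>2"
        unfolding v_def using t by (intro vector_derivative_within_closed_interval) auto
      then have v0: "v \<noteq> 0" using s q e by auto
      have ct: "c t = cayley_inverse q" using t by (simp add: c radial_point_def q_def)
      have uhp: "c t \<in> upper_half_plane"
        using t e by (simp add: c radial_point_in_upper_half_plane)
      then have Im: "Im (c t) > 0" by (simp add: upper_half_plane_def)
      have T: "T t = v /\<^sub>R (cmod v / Im (c t))"
        using ref t unfolding reference_field_def if_not_P[OF nonconst] Let_def v_def by blast
      have UT: "(c t, T t) \<in> UT"
        using uhp v0 Im by (simp add: UT_def T)
      have "c t + \<i> = 2 * \<i> / (1 - q)"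
        using q by (simp add: ct cayley_inverse_def field_simps)
      then have v_disc: "v / (c t + \<i>)\<^sup>2 = - (of_real (s / 4) * (\<i> * e))"
        using q by (simp add: v power_divide power_mult_distrib)
      have "disc_vector (c t, T t) = - (of_real (Im (c t) / cmod v) * (v / (c t + \<i>)\<^sup>2))"
        by (simp add: disc_vector_def T scaleR_conv_of_real)
      then have "disc_vector (c t, T t) = of_real (Im (c t) / cmod v * (s / 4)) * (\<i> * e)"
        unfolding v_disc by simp
      moreover have "cis (Arg (\<i> * e)) = \<i> * e"
        by (rule cis_Arg_unit) (simp add: norm_mult e)
      moreover have "Im (c t) / cmod v * (s / 4) > 0"
        using Im v0 s by simp
      ultimately show ?thesis using UT by metis
    qed
    show thesis by (rule that[of "Arg (\<i> * e)"]) (use * in auto)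
  qed
qed

lemma reference_field_exists:
  assumes "c 0 \<in> upper_half_plane"
  shows "\<exists>T. reference_field c T"
proof (cases "\<forall>t\<in>{0..1}. c t = c 0")
  case True
  have "(c 0, of_real (Im (c 0))) \<in> UT"
    using assms by (simp add: UT_def upper_half_plane_def)
  then show ?thesis
    unfolding reference_field_def if_P[OF True]
    by (intro exI[of _ "\<lambda>t. of_real (Im (c 0))"] exI[of _ "of_real (Im (c 0))"]) simp
next
  case False
  then show ?thesis
    unfolding reference_field_def if_not_P[OF False] Let_def by (intro exI) (rule ballI refl)+
qed


section \<open>Homotopy classes of paths\<close>

lemma path_class_eqI:
  assumes "homotopic_paths X p q"
  shows "path_class X p = path_class X q"
  using assms homotopic_paths_trans homotopic_paths_sym unfolding path_class_def by blast

lemma path_class_eqD: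
  assumes "path_class X p = path_class X q" "path q" "path_image q \<subseteq> X"
  shows "homotopic_paths X p q"
  using assms by (auto simp: path_class_def set_eq_iff)

lemma lift_map_path_class:
  assumes p: "path p" "path_image p \<subseteq> X" and f: "continuous_on X f" "f \<in> X \<rightarrow> Y"
  shows "lift_map Y f (path_class X p) = path_class Y (f \<circ> p)"
proof -
  have "path_class Y (f \<circ> q) = path_class Y (f \<circ> p)" if "q \<in> path_class X p" for q
    using that f by (intro path_class_eqI homotopic_paths_continuous_image[OF homotopic_paths_sym])
      (auto simp: path_class_def)
  moreover have "p \<in> path_class X p"
    using p by (simp add: path_class_def)
  then have "path_class X p \<noteq> {}" by blast
  ultimately show ?thesis unfolding lift_map_def by (intro SUP_eq_const)
qed

text \<open>As \<open>\<H> \<times> \<real>\<close> is convex, a path in a space with such coordinates is determined up to homotopy by the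
  endpoints of its coordinates. This is how homotopies of unit tangent vectors and of matrices arise.\<close>

lemma homotopic_paths_coordinates:
  fixes z z' :: "real \<Rightarrow> complex" and \<phi> \<phi>' :: "real \<Rightarrow> real"
  assumes z: "path z" "path_image z \<subseteq> upper_half_plane" "path z'" "path_image z' \<subseteq> upper_half_plane"
    "z 0 = z' 0" "z 1 = z' 1"
    and \<phi>: "continuous_on {0..1} \<phi>" "continuous_on {0..1} \<phi>'" "\<phi> 0 = \<phi>' 0" "\<phi> 1 = \<phi>' 1"
    and f: "continuous_on (upper_half_plane \<times> UNIV) f" "f \<in> upper_half_plane \<times> UNIV \<rightarrow> Y"
  shows "homotopic_paths Y (\<lambda>t. f (z t, \<phi> t)) (\<lambda>t. f (z' t, \<phi>' t))"
proof -
  have "homotopic_paths (upper_half_plane \<times> UNIV) (\<lambda>t. (z t, \<phi> t)) (\<lambda>t. (z' t, \<phi>' t))"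
  proof (rule homotopic_paths_linear)
    show "path (\<lambda>t. (z t, \<phi> t))" "path (\<lambda>t. (z' t, \<phi>' t))"
      using z(1,3) \<phi>(1,2) unfolding path_def by (simp_all add: continuous_on_Pair)
    show "pathstart (\<lambda>t. (z' t, \<phi>' t)) = pathstart (\<lambda>t. (z t, \<phi> t))"
      "pathfinish (\<lambda>t. (z' t, \<phi>' t)) = pathfinish (\<lambda>t. (z t, \<phi> t))"
      using z \<phi> by (auto simp: pathstart_def pathfinish_def)
    show "closed_segment (z t, \<phi> t) (z' t, \<phi>' t) \<subseteq> upper_half_plane \<times> UNIV" if "t \<in> {0..1}" for t
      using z that by (intro closed_segment_subset convex_Times convex_upper_half_plane)
        (auto simp: path_image_def)
  qed
  from homotopic_paths_continuous_image[OF this f] show ?thesis by (simp add: o_def)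
qed

lemma path_compose_SL2:
  assumes "path A" "path_image A \<subseteq> SL2" "continuous_on SL2 f"
  shows "path (f \<circ> A)"
  using assms by (intro path_continuous_image) (auto intro: continuous_on_subset)

lemma argument_along_disc_vector:
  assumes A: "path_image A \<subseteq> SL2" and \<theta>: "argument_along (rotation_part \<circ> A) \<theta>" and u: "cmod u = 1"
  shows "argument_along (disc_vector \<circ> ((\<lambda>g. tangent_map g (\<i>, u)) \<circ> (abs_psl2 \<circ> A)))
    (\<lambda>t. 2 * \<theta> t + Arg u)"
  unfolding argument_along_def
proof (intro conjI ballI)
  show "continuous_on {0..1} (\<lambda>t. 2 * \<theta> t + Arg u)"
    using argument_alongD(1)[OF \<theta>] by (intro continuous_intros)
next
  fix t :: real assume t: "t \<in> {0..1}"
  then obtain r where r: "r > 0" "rotation_part (A t) = of_real r * cis (\<theta> t)"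
    using argument_alongE[OF \<theta>, of t] by auto
  have "A t \<in> SL2" using A t by (auto simp: path_image_def)
  note disc_vector_tangent_map[OF this r, of u]
  also have "cis (2 * \<theta> t) * u = cis (2 * \<theta> t + Arg u)"
    by (simp add: cis_mult [symmetric] cis_Arg_unit u)
  finally show "\<exists>r>0. (disc_vector \<circ> ((\<lambda>g. tangent_map g (\<i>, u)) \<circ> (abs_psl2 \<circ> A))) t =
      of_real r * cis (2 * \<theta> t + Arg u)"
    using r(1) by (intro exI[of _ "1 / r\<^sup>2"]) simp
qed

lemma homotopic_tangent_paths:
  assumes "homotopic_paths UNIV g h" and "cmod u = 1"
  shows "homotopic_paths UT ((\<lambda>g. tangent_map g (\<i>, u)) \<circ> g) ((\<lambda>g. tangent_map g (\<i>, u)) \<circ> h)"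
  using assms
  by (intro homotopic_paths_continuous_image[OF assms(1) continuous_on_tangent_map])
    (simp add: tangent_map_in_UT)

lemma homotopic_disc_vectors:
  assumes "homotopic_paths UT V W"
  shows "homotopic_paths (- {0}) (disc_vector \<circ> V) (disc_vector \<circ> W)"
  using assms continuous_on_disc_vector
  by (rule homotopic_paths_continuous_image) (simp add: disc_vector_nonzero Pi_iff)


section \<open>The twist at \<open>\<i>\<close>\<close>

text \<open>The reference field has constant argument \<open>\<tau>\<close> in the disc, so \<open>V\<close> has argument \<open>\<psi> + \<tau>\<close> there.
  Being homotopic to \<open>t \<mapsto> Dg\<^sub>t(u)\<close>, whose argument is \<open>2 \<theta>\<close> plus a constant, it has the same change of
  argument.\<close>

lemma is_twist_unique:
  assumes A: "path A" "path_image A \<subseteq> SL2" and \<theta>: "argument_along (rotation_part \<circ> A) \<theta>"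
    and twist: "is_twist (path_class UNIV (abs_psl2 \<circ> A)) \<i> r"
  shows "r = 2 * (\<theta> 1 - \<theta> 0)"
proof -
  obtain g c u V T \<psi> where g: "homotopic_paths UNIV (abs_psl2 \<circ> A) g"
    and geo: "geodesic_from_to c \<i> (act (g 1) \<i>)" and u: "(\<i>, u) \<in> UT"
    and V: "homotopic_paths UT (\<lambda>t. tangent_map (g t) (\<i>, u)) V" "\<And>t. t \<in> {0..1} \<Longrightarrow> fst (V t) = c t"
    and ref: "reference_field c T" and \<psi>: "angle_from_to T (snd \<circ> V) \<psi>" and r: "r = \<psi> 1 - \<psi> 0"
    using twist unfolding is_twist_def path_class_def by auto
  have norm_u: "cmod u = 1" using u by (simp add: UT_def)
  obtain \<tau> where \<tau>: "\<And>t. t \<in> {0..1} \<Longrightarrow> \<exists>r>0. disc_vector (c t, T t) = of_real r * cis \<tau>"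
    using reference_field_argument[OF geo ref] by blast
  have "homotopic_paths UT ((\<lambda>g. tangent_map g (\<i>, u)) \<circ> (abs_psl2 \<circ> A)) V"
    using homotopic_paths_trans[OF homotopic_tangent_paths[OF g norm_u]] V(1) by (simp add: o_def)
  note hom = homotopic_disc_vectors[OF this]
  have "argument_along (disc_vector \<circ> V) (\<lambda>t. \<psi> t + \<tau>)"
    unfolding argument_along_def
  proof (intro conjI ballI)
    show "continuous_on {0..1} (\<lambda>t. \<psi> t + \<tau>)"
      using \<psi> by (auto simp: angle_from_to_def intro!: continuous_intros)
    fix t :: real assume t: "t \<in> {0..1}"
    have "V t = (c t, cis (\<psi> t) * T t)"
      using \<psi> t V(2)[OF t] by (simp add: angle_from_to_def prod_eq_iff)
    then have "disc_vector (V t) = cis (\<psi> t) * disc_vector (c t, T t)"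
      by (simp add: disc_vector_def)
    with \<tau>[OF t] show "\<exists>r>0. (disc_vector \<circ> V) t = of_real r * cis (\<psi> t + \<tau>)"
      by (auto simp: cis_mult [symmetric])
  qed
  from argument_along_homotopic[OF hom argument_along_disc_vector[OF A(2) \<theta> norm_u] this]
  show ?thesis by (simp add: r)
qed

text \<open>The path of tangent vectors \<open>t \<mapsto> Dg\<^sub>t(1)\<close> has coordinates \<open>(g\<^sub>t(\<i>), 2 \<theta>(t))\<close>. Moving only the
  base points, with the argument in the disc kept fixed, yields a homotopic path \<open>V\<close> along the
  geodesic.\<close>

lemma is_twist_exists:
  assumes A: "path A" "path_image A \<subseteq> SL2" "A 0 = mat 1"
    and \<theta>: "argument_along (rotation_part \<circ> A) \<theta>"
  shows "is_twist (path_class UNIV (abs_psl2 \<circ> A)) \<i> (2 * (\<theta> 1 - \<theta> 0))"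
proof -
  define g where "g = abs_psl2 \<circ> A"
  define p where "p = (\<lambda>t. tangent_map (g t) (\<i>, 1))"
  define z where "z = (\<lambda>t. act (g t) \<i>)"
  have path_g: "path g"
    unfolding g_def using A(1,2) continuous_on_abs_psl2 by (rule path_compose_SL2)
  have p: "path p" "\<And>t. p t \<in> UT" "\<And>t. fst (p t) = z t"
    using path_tangent_map[OF path_g, of 1] by (simp_all add: p_def z_def tangent_map_in_UT)
  have z: "path z" "\<And>t. z t \<in> upper_half_plane"
    using path_act_i[OF path_g] by (simp_all add: z_def act_i_in_upper_half_plane)
  have p_frame: "p t = frame_vector (z t, 2 * \<theta> t)" if t: "t \<in> {0..1}" for t
  proof -
    obtain r where "r > 0" "disc_vector (p t) = of_real r * cis (2 * \<theta> t)"
      using argument_alongE[OF argument_along_disc_vector[OF A(2) \<theta> norm_one] t]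
      by (auto simp: p_def g_def Arg_1)
    then show ?thesis
      using frame_vector_eqI[of "z t" "snd (p t)"] p(2)[of t] p(3)[of t] by (metis prod.collapse)
  qed
  obtain c where c: "geodesic_from_to c \<i> (z 1)"
    using z(2) by (rule geodesic_from_i_exists)
  then have c_uhp: "c t \<in> upper_half_plane" if "t \<in> {0..1}" for t
    using that by (simp add: geodesic_from_to_def)
  obtain T where T: "reference_field c T"
    using reference_field_exists[of c] c_uhp[of 0] by auto
  obtain \<tau> where \<tau>: "\<And>t. t \<in> {0..1} \<Longrightarrow> (c t, T t) \<in> UT"
    "\<And>t. t \<in> {0..1} \<Longrightarrow> \<exists>r>0. disc_vector (c t, T t) = of_real r * cis \<tau>"
    using reference_field_argument[OF c T] by blast
  define V where "V = (\<lambda>t. frame_vector (c t, 2 * \<theta> t))"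
  have "homotopic_paths UT (\<lambda>t. frame_vector (z t, 2 * \<theta> t)) V"
    unfolding V_def
  proof (rule homotopic_paths_coordinates)
    show "path z" "path c" using z c path_geodesic_from_i by auto
    show "path_image z \<subseteq> upper_half_plane" "path_image c \<subseteq> upper_half_plane"
      using z c_uhp by (auto simp: path_image_def)
    show "z 0 = c 0" "z 1 = c 1"
      using c A(3) by (simp_all add: geodesic_from_to_def z_def g_def act_identity_i)
    show "continuous_on {0..1} (\<lambda>t. 2 * \<theta> t)" "continuous_on {0..1} (\<lambda>t. 2 * \<theta> t)"
      using argument_alongD(1)[OF \<theta>] by (auto intro!: continuous_intros)
    show "continuous_on (upper_half_plane \<times> UNIV) frame_vector" by (rule continuous_on_frame_vector)
    show "frame_vector \<in> upper_half_plane \<times> UNIV \<rightarrow> UT" by (auto simp: frame_vector_in_UT)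
  qed simp_all
  moreover have "homotopic_paths UT p (\<lambda>t. frame_vector (z t, 2 * \<theta> t))"
    using p(1) _ p_frame
  proof (rule homotopic_paths_eq)
    show "path_image p \<subseteq> UT" using p(2) by (auto simp: path_image_def)
  qed
  ultimately have "homotopic_paths UT (\<lambda>t. tangent_map (g t) (\<i>, 1)) V"
    unfolding p_def by (rule homotopic_paths_trans [rotated])
  moreover have "angle_from_to T (snd \<circ> V) (\<lambda>t. 2 * \<theta> t - \<tau>)"
    unfolding angle_from_to_def
  proof (intro conjI ballI)
    show "continuous_on {0..1} (\<lambda>t. 2 * \<theta> t - \<tau>)"
      using argument_alongD(1)[OF \<theta>] by (intro continuous_intros)
    fix t :: real assume t: "t \<in> {0..1}"
    then have "(c t, T t) = frame_vector (c t, \<tau>)"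
      using frame_vector_eqI \<tau> by blast
    then show "(snd \<circ> V) t = cis (2 * \<theta> t - \<tau>) * T t"
      by (simp add: V_def frame_vector_def cis_divide [symmetric])
  qed
  moreover have "g \<in> path_class UNIV (abs_psl2 \<circ> A)"
    using path_g by (simp add: path_class_def g_def)
  moreover have "(\<i>, 1) \<in> UT" by (simp add: UT_def upper_half_plane_def)
  moreover have "\<forall>t\<in>{0..1}. fst (V t) = c t" by (simp add: V_def frame_vector_def)
  ultimately show ?thesis
    unfolding is_twist_def
    using c T unfolding z_def
    by (intro exI[of _ g] exI[of _ c] exI[of _ 1] exI[of _ V] exI[of _ T] exI[of _ "\<lambda>t. 2 * \<theta> t - \<tau>"])
      (simp add: algebra_simps)
qed

lemma Tw_eq:
  assumes "path A" "path_image A \<subseteq> SL2" "A 0 = mat 1" "argument_along (rotation_part \<circ> A) \<theta>"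
  shows "Tw (path_class UNIV (abs_psl2 \<circ> A)) \<i> = 2 * (\<theta> 1 - \<theta> 0)"
  unfolding Tw_def
  using is_twist_exists[OF assms] is_twist_unique[OF assms(1,2,4)] by (rule the_equality)


section \<open>Milnor's angle function\<close>

lemma argument_along_rotation_part_exists:
  assumes A: "path A" "path_image A \<subseteq> SL2" "A 0 = mat 1"
  obtains \<theta> where "argument_along (rotation_part \<circ> A) \<theta>" "\<theta> 0 = 0"
proof (rule argument_along_exists_from_0)
  show "path (rotation_part \<circ> A)"
    using A continuous_on_rotation_part by (intro path_compose_SL2)
  show "path_image (rotation_part \<circ> A) \<subseteq> - {0}"
    using A(2) rotation_part_nonzero by (fastforce simp: path_image_def)
  show "(rotation_part \<circ> A) 0 = of_real 2" by (simp add: A(3))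
qed (use that in auto)

lemma polar_matrix_along:
  assumes "path_image A \<subseteq> SL2" "argument_along (rotation_part \<circ> A) \<theta>" "t \<in> {0..1}"
  shows "A t = polar_matrix (mobius (A t) \<i>, \<theta> t)"
proof -
  obtain r where "r > 0" "rotation_part (A t) = of_real r * cis (\<theta> t)"
    using argument_alongE[OF assms(2,3)] by auto
  moreover have "A t \<in> SL2" using assms(1,3) by (auto simp: path_image_def)
  ultimately show ?thesis by (intro polar_matrix_eqI)
qed

text \<open>The image in the projective group knows the point \<open>A \<i>\<close> and the angle \<open>2 \<theta>\<close>, hence the endpoints of
  both polar coordinates of the two lifts agree.\<close>

lemma homotopic_lifts:
  assumes A: "path A" "path_image A \<subseteq> SL2" "A 0 = mat 1"
    and B: "path B" "path_image B \<subseteq> SL2" "B 0 = mat 1"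
    and hom: "homotopic_paths UNIV (abs_psl2 \<circ> A) (abs_psl2 \<circ> B)"
  shows "homotopic_paths SL2 A B"
proof -
  obtain \<theta> where \<theta>: "argument_along (rotation_part \<circ> A) \<theta>" "\<theta> 0 = 0"
    using A by (rule argument_along_rotation_part_exists)
  obtain \<phi> where \<phi>: "argument_along (rotation_part \<circ> B) \<phi>" "\<phi> 0 = 0"
    using B by (rule argument_along_rotation_part_exists)
  have one: "cmod 1 = 1" by simp
  have "2 * \<theta> 1 + Arg 1 - (2 * \<theta> 0 + Arg 1) = 2 * \<phi> 1 + Arg 1 - (2 * \<phi> 0 + Arg 1)"
    by (rule argument_along_homotopic[OF homotopic_disc_vectors[OF homotopic_tangent_paths[OF hom one]]
          argument_along_disc_vector[OF A(2) \<theta>(1) one] argument_along_disc_vector[OF B(2) \<phi>(1) one]])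
  then have finish: "\<theta> 1 = \<phi> 1" using \<theta> \<phi> by simp
  have SL2: "A t \<in> SL2" "B t \<in> SL2" if "t \<in> {0..1}" for t
    using that A B by (auto simp: path_image_def)
  have cont: "continuous_on SL2 (\<lambda>A. mobius A \<i>)"
    unfolding mobius_i using denominator_i_nonzero unfolding denominator_i_def Complex_eq
    by (auto intro!: continuous_intros)
  have "homotopic_paths SL2 (\<lambda>t. polar_matrix (mobius (A t) \<i>, \<theta> t)) (\<lambda>t. polar_matrix (mobius (B t) \<i>, \<phi> t))"
  proof (rule homotopic_paths_coordinates)
    show "path (\<lambda>t. mobius (A t) \<i>)" "path (\<lambda>t. mobius (B t) \<i>)"
      using path_compose_SL2[OF A(1,2) cont] path_compose_SL2[OF B(1,2) cont] by (simp_all add: o_def)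
    show "path_image (\<lambda>t. mobius (A t) \<i>) \<subseteq> upper_half_plane" "path_image (\<lambda>t. mobius (B t) \<i>) \<subseteq> upper_half_plane"
      using SL2 mobius_i_in_upper_half_plane by (auto simp: path_image_def)
    have "abs_psl2 (A 1) = abs_psl2 (B 1)"
      using homotopic_paths_imp_pathfinish[OF hom] by (simp add: pathfinish_def)
    then show "mobius (A 1) \<i> = mobius (B 1) \<i>"
      using SL2[of 1] by (metis act_abs_psl2 atLeastAtMost_iff order_refl zero_le_one)
    show "continuous_on (upper_half_plane \<times> UNIV) polar_matrix" by (rule continuous_on_polar_matrix)
    show "polar_matrix \<in> upper_half_plane \<times> UNIV \<rightarrow> SL2" by (auto simp: polar_matrix_in_SL2)
  qed (use A B \<theta> \<phi> finish argument_alongD(1) in auto)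
  moreover have "homotopic_paths SL2 A (\<lambda>t. polar_matrix (mobius (A t) \<i>, \<theta> t))"
    using A \<theta> polar_matrix_along by (intro homotopic_paths_eq) auto
  moreover have "homotopic_paths SL2 B (\<lambda>t. polar_matrix (mobius (B t) \<i>, \<phi> t))"
    using B \<phi> polar_matrix_along by (intro homotopic_paths_eq) auto
  ultimately show ?thesis by (meson homotopic_paths_sym homotopic_paths_trans)
qed

lemma proj_tilde_path_class:
  assumes "path A" "path_image A \<subseteq> SL2"
  shows "proj_tilde (path_class SL2 A) = path_class UNIV (abs_psl2 \<circ> A)"
  unfolding proj_tilde_def
  using assms continuous_on_abs_psl2 by (rule lift_map_path_class) simp

lemma inj_on_proj_tilde: "inj_on proj_tilde SL2_tilde"
proof (rule inj_onI)
  fix \<xi> \<eta> assume "\<xi> \<in> SL2_tilde" "\<eta> \<in> SL2_tilde" and eq: "proj_tilde \<xi> = proj_tilde \<eta>"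
  then obtain A B where A: "path A" "path_image A \<subseteq> SL2" "A 0 = mat 1" "\<xi> = path_class SL2 A"
    and B: "path B" "path_image B \<subseteq> SL2" "B 0 = mat 1" "\<eta> = path_class SL2 B"
    by (auto simp: SL2_tilde_def universal_cover_def pathstart_def)
  have "homotopic_paths UNIV (abs_psl2 \<circ> A) (abs_psl2 \<circ> B)"
    using eq A B path_compose_SL2[OF B(1,2) continuous_on_abs_psl2]
    by (intro path_class_eqD) (simp_all add: proj_tilde_path_class)
  then show "\<xi> = \<eta>"
    unfolding A(4) B(4) using A(1-3) B(1-3) by (intro path_class_eqI homotopic_lifts)
qed

text \<open>A path in the projective group is lifted by lifting its coordinates: the base point of
  \<open>t \<mapsto> Dp\<^sub>t(1)\<close>, and half of a continuous argument \<open>\<psi>\<close> of its disc vector. The matrices with these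
  polar coordinates represent \<open>p\<^sub>t\<close>, since \<open>\<psi>\<close> determines the rotation factor up to sign.\<close>

lemma PSL2_tilde_lift:
  assumes "\<alpha> \<in> PSL2_tilde"
  obtains A where "path A" "path_image A \<subseteq> SL2" "A 0 = mat 1" "\<alpha> = path_class UNIV (abs_psl2 \<circ> A)"
proof -
  obtain p where p: "path p" "p 0 = abs_psl2 (mat 1)" "\<alpha> = path_class UNIV p"
    using assms by (auto simp: PSL2_tilde_def universal_cover_def pathstart_def)
  define q where "q = (\<lambda>t. tangent_map (p t) (\<i>, 1))"
  define z where "z = (\<lambda>t. act (p t) \<i>)"
  have q: "path q" "\<And>t. q t \<in> UT"
    using path_tangent_map[OF p(1), of 1] by (simp_all add: q_def tangent_map_in_UT)
  have z: "path z" "\<And>t. z t \<in> upper_half_plane"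
    using path_act_i[OF p(1)] by (simp_all add: z_def act_i_in_upper_half_plane)
  have "path (disc_vector \<circ> q)"
    using q by (intro path_continuous_image continuous_on_subset[OF continuous_on_disc_vector])
      (auto simp: path_image_def)
  moreover have "path_image (disc_vector \<circ> q) \<subseteq> - {0}"
    using disc_vector_nonzero[OF q(2)] by (auto simp: path_image_def)
  moreover have "(disc_vector \<circ> q) 0 = of_real (1 / 4)"
    using disc_vector_tangent_map[of "mat 1" 2 0 1] by (simp add: q_def p(2))
  ultimately obtain \<psi> where \<psi>: "argument_along (disc_vector \<circ> q) \<psi>" "\<psi> 0 = 0"
    by (rule argument_along_exists_from_0) simp
  define A where "A = (\<lambda>t. polar_matrix (z t, \<psi> t / 2))"
  have "path A"
  proof -
    have "continuous_on {0..1} (\<lambda>t. (z t, \<psi> t / 2))"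
      using z(1) argument_alongD(1)[OF \<psi>(1)] unfolding path_def
      by (intro continuous_on_Pair continuous_on_divide continuous_on_const) simp_all
    then show ?thesis
      unfolding A_def path_def using z(2)
      by (intro continuous_on_compose2[OF continuous_on_polar_matrix]) auto
  qed
  moreover have "path_image A \<subseteq> SL2"
    using z(2) by (auto simp: A_def path_image_def polar_matrix_in_SL2)
  moreover have "A 0 = polar_matrix (\<i>, 0)"
    by (simp add: A_def z_def p(2) act_identity_i \<psi>(2))
  then have "A 0 = mat 1"
    using polar_matrix_eqI[of "mat 1" 2 0] by (simp add: mobius_mat_1)
  moreover have "p t = (abs_psl2 \<circ> A) t" if t: "t \<in> {0..1}" for t
  proof -
    obtain B where B: "B \<in> SL2" "p t = abs_psl2 B" by (rule psl2_cases)
    define r \<beta> where "r = cmod (rotation_part B)" and "\<beta> = Arg (rotation_part B)"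
    have r: "r > 0" using rotation_part_nonzero[OF B(1)] by (simp add: r_def)
    have k: "rotation_part B = of_real r * cis \<beta>"
      by (simp add: r_def \<beta>_def norm_times_cis_Arg)
    obtain s where s: "s > 0" "disc_vector (q t) = of_real s * cis (\<psi> t)"
      using argument_alongE[OF \<psi>(1) t] by auto
    then have eq: "of_real (1 / r\<^sup>2) * cis (2 * \<beta>) = of_real s * cis (\<psi> t)"
      using disc_vector_tangent_map[OF B(1) r k, of 1] by (simp add: q_def B(2))
    have "cmod (of_real (1 / r\<^sup>2) * cis (2 * \<beta>)) = cmod (of_real s * cis (\<psi> t))"
      by (simp only: eq)
    then have "1 / r\<^sup>2 = s"
      using r s(1) by (simp add: norm_mult norm_divide norm_power)
    then have "of_real s * cis (2 * \<beta>) = of_real s * cis (\<psi> t)"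
      using eq by (simp only:)
    then have "cis (2 * \<beta>) = cis (\<psi> t)" using s(1) by simp
    then have "(cis \<beta>)\<^sup>2 = (cis (\<psi> t / 2))\<^sup>2"
      by (simp add: power2_eq_square cis_mult)
    then consider "cis \<beta> = cis (\<psi> t / 2)" | "cis \<beta> = - cis (\<psi> t / 2)"
      by (auto simp: power2_eq_iff)
    then obtain C where C: "C \<in> SL2" "p t = abs_psl2 C" "rotation_part C = of_real r * cis (\<psi> t / 2)"
    proof cases
      case 1
      then show thesis using that[of B] B k by simp
    next
      case 2
      then show thesis using that[of "- B"] B k by (simp add: abs_psl2_eq_iff)
    qed
    then have "C = polar_matrix (z t, \<psi> t / 2)"
      using polar_matrix_eqI[OF C(1) r C(3)] by (simp add: z_def act_abs_psl2)
    then show ?thesis by (simp add: A_def C(2))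
  qed
  then have "\<alpha> = path_class UNIV (abs_psl2 \<circ> A)"
    unfolding p(3) using p(1) by (intro path_class_eqI homotopic_paths_eq) auto
  ultimately show thesis by (rule that)
qed

lemma continuous_on_SO2_exp: "continuous_on X SO2_exp"
  unfolding SO2_exp_def by (intro continuous_on_mat22 continuous_intros)

lemma polar_rotation_eq_sgn:
  assumes "A \<in> SL2"
  shows "polar_rotation A = vector [vector [Re (sgn (rotation_part A)), Im (sgn (rotation_part A))],
    vector [- Im (sgn (rotation_part A)), Re (sgn (rotation_part A))]]"
proof -
  let ?k = "rotation_part A"
  have "polar_rotation A = SO2_exp (Arg ?k)"
    using rotation_part_nonzero[OF assms]
    by (intro polar_rotation_eq[OF assms, of "cmod ?k"]) (simp_all add: norm_times_cis_Arg)
  moreover have "sgn ?k = cis (Arg ?k)"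
    using rotation_part_nonzero[OF assms] by (simp add: cis_Arg)
  ultimately show ?thesis by (simp add: SO2_exp_def)
qed

lemma continuous_on_polar_rotation: "continuous_on SL2 polar_rotation"
proof (rule continuous_on_eq)
  show "continuous_on SL2 (\<lambda>A. vector [vector [Re (sgn (rotation_part A)), Im (sgn (rotation_part A))],
    vector [- Im (sgn (rotation_part A)), Re (sgn (rotation_part A))]] :: real^2^2)"
    using rotation_part_nonzero by (intro continuous_on_mat22 continuous_intros) auto
qed (rule polar_rotation_eq_sgn [symmetric])

lemma polar_rotation_in_SO2: "A \<in> SL2 \<Longrightarrow> polar_rotation A \<in> SO2"
  using polar_rotation_eq[of A "cmod (rotation_part A)" "Arg (rotation_part A)"]
    rotation_part_nonzero[of A]
  by (simp add: norm_times_cis_Arg SO2_eq_range)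

text \<open>The rotation factors of \<open>A\<close> form the path \<open>exp \<circ> \<theta>\<close>, and in \<open>\<real>\<close> the path \<open>\<theta>\<close> is homotopic to the
  segment from \<open>0\<close> to \<open>\<theta>(1)\<close>.\<close>

lemma R_tilde_path_class:
  assumes A: "path A" "path_image A \<subseteq> SL2" and \<theta>: "argument_along (rotation_part \<circ> A) \<theta>" "\<theta> 0 = 0"
  shows "R_tilde (path_class SL2 A) = exp_tilde (\<theta> 1)"
proof -
  have "R_tilde (path_class SL2 A) = path_class SO2 (polar_rotation \<circ> A)"
    unfolding R_tilde_def using A continuous_on_polar_rotation
    by (rule lift_map_path_class) (simp add: polar_rotation_in_SO2 Pi_iff)
  also have "\<dots> = path_class SO2 (SO2_exp \<circ> \<theta>)"
  proof (rule path_class_eqI, rule homotopic_paths_eq)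
    show "path (polar_rotation \<circ> A)"
      using A continuous_on_polar_rotation by (rule path_compose_SL2)
    show "path_image (polar_rotation \<circ> A) \<subseteq> SO2"
      using A(2) by (auto simp: path_image_def polar_rotation_in_SO2)
    fix t :: real assume t: "t \<in> {0..1}"
    then obtain r where "r > 0" "rotation_part (A t) = of_real r * cis (\<theta> t)"
      using argument_alongE[OF \<theta>(1), of t] by auto
    moreover have "A t \<in> SL2" using A(2) t by (auto simp: path_image_def)
    ultimately show "(polar_rotation \<circ> A) t = (SO2_exp \<circ> \<theta>) t"
      by (simp add: polar_rotation_eq)
  qed
  also have "\<dots> = path_class SO2 (SO2_exp \<circ> (\<lambda>t. t * \<theta> 1))"
  proof (rule path_class_eqI, rule homotopic_paths_continuous_image)
    show "homotopic_paths UNIV \<theta> (\<lambda>t. t * \<theta> 1)"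
      using argument_alongD(1)[OF \<theta>(1)] \<theta>(2)
      by (intro homotopic_paths_linear)
        (auto simp: path_def pathstart_def pathfinish_def intro!: continuous_intros)
  qed (auto simp: continuous_on_SO2_exp SO2_eq_range)
  finally show ?thesis by (simp add: exp_tilde_def o_def)
qed

lemma inj_exp_tilde: "inj exp_tilde"
proof (rule injI)
  fix x y assume eq: "exp_tilde x = exp_tilde y"
  have "path (\<lambda>t. SO2_exp (t * y))"
    unfolding path_def by (intro continuous_on_compose2[OF continuous_on_SO2_exp[of UNIV]] continuous_intros) simp
  then have "homotopic_paths SO2 (\<lambda>t. SO2_exp (t * x)) (\<lambda>t. SO2_exp (t * y))"
    using eq unfolding exp_tilde_def by (intro path_class_eqD) (auto simp: path_image_def SO2_eq_range)
  moreover have rot: "rotation_part (SO2_exp \<theta>) = of_real 2 * cis \<theta>" for \<theta>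
    by (simp add: rotation_part_def complex_eq_iff)
  ultimately have "homotopic_paths (- {0}) (rotation_part \<circ> (\<lambda>t. SO2_exp (t * x))) (rotation_part \<circ> (\<lambda>t. SO2_exp (t * y)))"
    by (intro homotopic_paths_continuous_image[OF _ continuous_on_rotation_part])
      (auto simp: SO2_eq_range)
  moreover have "argument_along (rotation_part \<circ> (\<lambda>t. SO2_exp (t * v))) (\<lambda>t. t * v)" for v
    unfolding argument_along_def
    by (auto simp: rot intro!: continuous_intros exI[of _ 2])
  ultimately show "x = y"
    using argument_along_homotopic by fastforce
qed

lemma Theta_eq:
  assumes A: "path A" "path_image A \<subseteq> SL2" "A 0 = mat 1"
    and \<theta>: "argument_along (rotation_part \<circ> A) \<theta>" "\<theta> 0 = 0"
  shows "Theta (path_class UNIV (abs_psl2 \<circ> A)) = \<theta> 1"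
proof -
  have "path_class SL2 A \<in> SL2_tilde"
    using A by (auto simp: SL2_tilde_def universal_cover_def pathstart_def)
  then have "the_inv_into SL2_tilde proj_tilde (path_class UNIV (abs_psl2 \<circ> A)) = path_class SL2 A"
    using A by (intro the_inv_into_f_eq[OF inj_on_proj_tilde]) (simp_all add: proj_tilde_path_class)
  then show ?thesis
    using A \<theta> by (simp add: Theta_def R_tilde_path_class the_inv_f_f[OF inj_exp_tilde])
qed


section \<open>The angle function is half the twist\<close>

theorem proposition4p1:
  fixes \<alpha> :: "(real \<Rightarrow> psl2) set"
  assumes "\<alpha> \<in> PSL2_tilde"
  shows "Theta \<alpha> = 1 / 2 * Tw \<alpha> \<i>"
proof -
  obtain A where A: "path A" "path_image A \<subseteq> SL2" "A 0 = mat 1"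
    and \<alpha>: "\<alpha> = path_class UNIV (abs_psl2 \<circ> A)"
    using assms by (rule PSL2_tilde_lift)
  obtain \<theta> where \<theta>: "argument_along (rotation_part \<circ> A) \<theta>" "\<theta> 0 = 0"
    using A by (rule argument_along_rotation_part_exists)
  show ?thesis
    unfolding \<alpha> Theta_eq[OF A \<theta>] Tw_eq[OF A \<theta>(1)] by (simp add: \<theta>(2))
qed

end
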